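(* Let $(\mathcal{M},\phi,\xi,\eta,g)$ be a 3-dimensional almost paracontact almost paracomplex Riemannian manifold (i.e. $n=1$), let $p\in\mathcal{M}$, and let $\{e_0=\xi,\ e_1=e,\ e_2=\phi e\}$ be an orthonormal basis of $T_p\mathcal{M}$. Write $F_{ijk}=F(e_i,e_j,e_k)$, $\theta_k=\theta(e_k)$, $\theta^*_k=\theta^*(e_k)$, $\omega_k=\omega(e_k)$, and for $x,y,z\in T_p\mathcal{M}$ write $x=x^ie_i$, $y=y^ie_i$, $z=z^ie_i$. Then the components $F_1,\dots,F_{11}$ of the fundamental tensor $F$ are \begin{align*} F_{1}(x,y,z)&=(x^1\theta_1-x^2\theta_2)(y^1z^1-y^2z^2),\\ F_{2}(x,y,z)&=F_{3}(x,y,z)=0,\\ F_{4}(x,y,z)&=\tfrac{\theta_0}{2}\{x^1(y^0z^1+y^1z^0)+x^2(y^0z^2+y^2z^0)\},\\ F_{5}(x,y,z)&=\tfrac{\theta^*_0}{2}\{x^1(y^0z^2+y^2z^0)+x^2(y^0z^1+y^1z^0)\},\\ F_{6}(x,y,z)&=F_{7}(x,y,z)=0,\\ F_{8}(x,y,z)&=\lambda\{x^1(y^0z^1+y^1z^0)-x^2(y^0z^2+y^2z^0)\},\\ F_{9}(x,y,z)&=\mu\{x^1(y^0z^2+y^2z^0)-x^2(y^0z^1+y^1z^0)\},\\ F_{10}(x,y,z)&=\nu\,x^0(y^1z^1-y^2z^2),\\ F_{11}(x,y,z)&=x^0\{\omega_1(y^0z^1+y^1z^0)+\omega_2(y^0z^2+y^2z^0)\},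 \end{align*} where $\lambda=F_{110}=-F_{220}$, $\mu=F_{120}=-F_{210}$, $\nu=F_{011}=-F_{022}$, and the components of the Lee forms are $\theta_0=F_{110}+F_{220}$, $\theta_1=F_{111}=-F_{122}=-\theta^*_2$, $\theta_2=F_{222}=-F_{211}=-\theta^*_1$, $\theta^*_0=F_{120}+F_{210}$, $\omega_0=0$, $\omega_1=F_{001}$, $\omega_2=F_{002}$.
   Context: Let $n\ge 1$. An almost paracontact almost paracomplex Riemannian manifold $(\mathcal{M},\phi,\xi,\eta,g)$ is a $(2n+1)$-dimensional smooth manifold with a $(1,1)$-tensor field $\phi$, a vector field $\xi$ and a 1-form $\eta$ such that $\phi\xi=0$, $\phi^2=I-\eta\otimes\xi$, $\eta\circ\phi=0$, $\eta(\xi)=1$, $\mathrm{tr}\,\phi=0$, and a Riemannian metric $g$ with $g(\phi x,\phi y)=g(x,y)-\eta(x)\eta(y)$, $g(x,\xi)=\eta(x)$. With $\nabla$ the Levi-Civita connection of $g$, the fundamental tensor is $F(x,y,z)=g((\nabla_x\phi)y,z)$. It satisfies $F(x,y,z)=F(x,z,y)=-F(x,\phi y,\phi z)+\eta(y)F(x,\xi,z)+\eta(z)F(x,y,\xi)$. Lee forms: for an orthonormal basis $e_1,\dots,e_{2n}$ of $\ker\eta$ at a point, $\theta(z)=\sum_{i=1}^{2n}F(e_i,e_i,z)$, $\theta^*(z)=\sum_{i=1}^{2n}F(e_i,\phi e_i,z)$, $\omega(z)=F(\xi,\xi,z)$. Components of $F$. For a $(0,2)$-tensor $S$ put $[S](x,y,z)=S(x,y)\eta(z)+S(x,z)\eta(y)$;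 put $b(x,y)=F(\phi^2x,\phi^2y,\xi)$ and $c(x,y)=F(\phi x,\phi y,\xi)$. Then $F_1(x,y,z)=\frac1{2n}\{g(\phi x,\phi y)\theta(\phi^2z)+g(\phi x,\phi z)\theta(\phi^2y)-g(x,\phi y)\theta(\phi z)-g(x,\phi z)\theta(\phi y)\}$; $F_2(x,y,z)=\frac14\{2F(\phi^2x,\phi^2y,\phi^2z)+F(\phi^2y,\phi^2z,\phi^2x)+F(\phi^2z,\phi^2x,\phi^2y)-F(\phi y,\phi z,\phi^2x)-F(\phi z,\phi y,\phi^2x)\}-F_1(x,y,z)$; $F_3(x,y,z)=\frac14\{2F(\phi^2x,\phi^2y,\phi^2z)-F(\phi^2y,\phi^2z,\phi^2x)-F(\phi^2z,\phi^2x,\phi^2y)+F(\phi y,\phi z,\phi^2x)+F(\phi z,\phi y,\phi^2x)\}$; $F_4=\frac{\theta(\xi)}{2n}[S]$ with $S(x,y)=g(\phi x,\phi y)$; $F_5=\frac{\theta^*(\xi)}{2n}[S]$ with $S(x,y)=g(x,\phi y)$; $F_6=\frac14[S]-F_4-F_5$ with $S(x,y)=b(x,y)+b(y,x)+c(x,y)+c(y,x)$; $F_7=\frac14[S]$ with $S(x,y)=b(x,y)-b(y,x)+c(x,y)-c(y,x)$; $F_8=\frac14[S]$ with $S(x,y)=b(x,y)+b(y,x)-c(x,y)-c(y,x)$; $F_9=\frac14[S]$ with $S(x,y)=b(x,y)-b(y,x)-c(x,y)+c(y,x)$; $F_{10}(x,y,z)=\eta(x)F(\xi,\phi^2y,\phi^2z)$;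 $F_{11}(x,y,z)=\eta(x)\{\eta(y)\omega(z)+\eta(z)\omega(y)\}$.
   Formalization: λ=F_110=-F_220 and μ=F_120=-F_210 fail for the full F in general; the formal statement uses λ=(F_110-F_220)/2, μ=(F_120-F_210)/2 (the components of F_8, F_9) and proves the literal equalities hold exactly when θ_0=0, resp. θ*_0=0. *)

theory Defs
  imports "HOL-Analysis.Analysis" "HOL-Library.Function_Algebras"
begin

instantiation "fun" :: (type, real_vector) real_vector
begin

definition scaleR_fun :: "real \<Rightarrow> ('a \<Rightarrow> 'b) \<Rightarrow> 'a \<Rightarrow> 'b"
  where "scaleR_fun a f = (\<lambda>x. a *\<^sub>R f x)"

instance
  by standard (simp_all add: scaleR_fun_def fun_eq_iff plus_fun_def scaleR_add_right scaleR_add_left)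

end

text \<open>\<open>C\<^sup>k\<close> and \<open>C\<^sup>\<infinity>\<close> maps; meaningful for open \<open>S\<close> only.\<close>

primrec Ck_on :: "nat \<Rightarrow> 'a set \<Rightarrow> ('a::euclidean_space \<Rightarrow> 'b::real_normed_vector) \<Rightarrow> bool"
  where
    "Ck_on 0 S f \<longleftrightarrow> continuous_on S f"
  | "Ck_on (Suc k) S f \<longleftrightarrow>
       (\<forall>u\<in>S. f differentiable (at u)) \<and> (\<forall>w. Ck_on k S (\<lambda>u. frechet_derivative f (at u) w))"

definition smooth_on :: "'a set \<Rightarrow> ('a::euclidean_space \<Rightarrow> 'b::real_normed_vector) \<Rightarrow> bool"
  where "smooth_on S f \<longleftrightarrow> (\<forall>k. Ck_on k S f)"

text \<open>A chart is a pair of a domain and a coordinate map; the values of the coordinate map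
  outside the domain are irrelevant.\<close>

type_synonym ('m, 'e) chart = "'m set \<times> ('m \<Rightarrow> 'e)"

definition is_chart :: "('m::topological_space, 'e::euclidean_space) chart \<Rightarrow> bool"
  where "is_chart c \<longleftrightarrow> open (fst c) \<and> open (snd c ` fst c) \<and>
    (\<exists>h. homeomorphism (fst c) (snd c ` fst c) (snd c) h)"

definition chart_inv :: "('m, 'e) chart \<Rightarrow> 'e \<Rightarrow> 'm"
  where "chart_inv c = inv_into (fst c) (snd c)"

definition transition :: "('m, 'e) chart \<Rightarrow> ('m, 'e) chart \<Rightarrow> 'e \<Rightarrow> 'e"
  where "transition c c' = snd c' \<circ> chart_inv c"

text \<open>A smooth manifold is a Hausdorff, second countable space (by the type class of \<open>'m\<close>)
  with a smooth atlas; its dimension is \<open>DIM('e)\<close>.\<close>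

definition smooth_atlas ::
    "('m::{t2_space, second_countable_topology}, 'e::euclidean_space) chart set \<Rightarrow> bool"
  where "smooth_atlas A \<longleftrightarrow> (\<forall>c\<in>A. is_chart c) \<and> \<Union> (fst ` A) = UNIV \<and>
    (\<forall>c\<in>A. \<forall>c'\<in>A. smooth_on (snd c ` (fst c \<inter> fst c')) (transition c c'))"

definition charts_at :: "('m, 'e) chart set \<Rightarrow> 'm \<Rightarrow> ('m, 'e) chart set"
  where "charts_at A p = {c \<in> A. p \<in> fst c}"

text \<open>A tangent vector at \<open>p\<close> assigns to each chart around \<open>p\<close> a coordinate vector, subject to
  the contravariant transformation law. The value \<open>0\<close> at all other charts is a normalisation,
  which makes the tangent space a subspace of the space of all such assignments.\<close>

type_synonym ('m, 'e) tvec = "('m, 'e) chart \<Rightarrow> 'e"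

definition tangent_space :: "('m, 'e::euclidean_space) chart set \<Rightarrow> 'm \<Rightarrow> ('m, 'e) tvec set"
  where "tangent_space A p = {v.
    (\<forall>c. c \<notin> charts_at A p \<longrightarrow> v c = 0) \<and>
    (\<forall>c\<in>charts_at A p. \<forall>c'\<in>charts_at A p.
       v c' = frechet_derivative (transition c c') (at (snd c p)) (v c))}"

definition smooth_fun_on :: "('m, 'e::euclidean_space) chart set \<Rightarrow> 'm set \<Rightarrow> ('m \<Rightarrow> real) \<Rightarrow> bool"
  where "smooth_fun_on A U f \<longleftrightarrow>
    (\<forall>c\<in>A. smooth_on (snd c ` (U \<inter> fst c)) (\<lambda>u. f (chart_inv c u)))"

definition smooth_field_on ::
    "('m, 'e::euclidean_space) chart set \<Rightarrow> 'm set \<Rightarrow> ('m \<Rightarrow> ('m, 'e) tvec) \<Rightarrow> bool"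
  where "smooth_field_on A U X \<longleftrightarrow> (\<forall>q\<in>U. X q \<in> tangent_space A q) \<and>
    (\<forall>c\<in>A. smooth_on (snd c ` (U \<inter> fst c)) (\<lambda>u. X (chart_inv c u) c))"

text \<open>The derivative \<open>v f\<close> of a function along a tangent vector at \<open>p\<close>; by the chain rule it
  does not depend on the chart.\<close>

definition deriv_along ::
    "('m, 'e::euclidean_space) chart set \<Rightarrow> 'm \<Rightarrow> ('m, 'e) tvec \<Rightarrow> ('m \<Rightarrow> real) \<Rightarrow> real"
  where "deriv_along A p v f = (let c = (SOME c. c \<in> charts_at A p) in
    frechet_derivative (\<lambda>u. f (chart_inv c u)) (at (snd c p)) (v c))"

definition lie_bracket ::
    "('m, 'e::euclidean_space) chart set \<Rightarrow> ('m \<Rightarrow> ('m, 'e) tvec) \<Rightarrow> ('m \<Rightarrow> ('m, 'e) tvec)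
      \<Rightarrow> 'm \<Rightarrow> ('m, 'e) tvec"
  where "lie_bracket A X Y p = (\<lambda>c. if c \<in> charts_at A p
    then frechet_derivative (\<lambda>u. Y (chart_inv c u) c) (at (snd c p)) (X p c)
       - frechet_derivative (\<lambda>u. X (chart_inv c u) c) (at (snd c p)) (Y p c)
    else 0)"

definition linear_within :: "'a::real_vector set \<Rightarrow> ('a \<Rightarrow> 'b::real_vector) \<Rightarrow> bool"
  where "linear_within V f \<longleftrightarrow> (\<forall>x\<in>V. \<forall>y\<in>V. f (x + y) = f x + f y) \<and>
    (\<forall>a. \<forall>x\<in>V. f (a *\<^sub>R x) = a *\<^sub>R f x)"

definition trace_within :: "'a::real_vector set \<Rightarrow> ('a \<Rightarrow> 'a) \<Rightarrow> real"
  where "trace_within V f = (let B = (SOME B. independent B \<and> span B = V) in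
    \<Sum>b\<in>B. representation B (f b) b)"

definition endomorphism_field ::
    "('m::topological_space, 'e::euclidean_space) chart set
      \<Rightarrow> ('m \<Rightarrow> ('m, 'e) tvec \<Rightarrow> ('m, 'e) tvec) \<Rightarrow> bool"
  where "endomorphism_field A \<phi> \<longleftrightarrow>
    (\<forall>p. linear_within (tangent_space A p) (\<phi> p) \<and>
         \<phi> p ` tangent_space A p \<subseteq> tangent_space A p) \<and>
    (\<forall>U X. open U \<longrightarrow> smooth_field_on A U X \<longrightarrow> smooth_field_on A U (\<lambda>q. \<phi> q (X q)))"

definition one_form ::
    "('m::topological_space, 'e::euclidean_space) chart set
      \<Rightarrow> ('m \<Rightarrow> ('m, 'e) tvec \<Rightarrow> real) \<Rightarrow> bool"
  where "one_form A \<eta> \<longleftrightarrow> (\<forall>p. linear_within (tangent_space A p) (\<eta> p)) \<and>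
    (\<forall>U X. open U \<longrightarrow> smooth_field_on A U X \<longrightarrow> smooth_fun_on A U (\<lambda>q. \<eta> q (X q)))"

definition riemannian_metric ::
    "('m::topological_space, 'e::euclidean_space) chart set
      \<Rightarrow> ('m \<Rightarrow> ('m, 'e) tvec \<Rightarrow> ('m, 'e) tvec \<Rightarrow> real) \<Rightarrow> bool"
  where "riemannian_metric A g \<longleftrightarrow>
    (\<forall>p. \<forall>x\<in>tangent_space A p. linear_within (tangent_space A p) (g p x) \<and>
         (\<forall>y\<in>tangent_space A p. g p x y = g p y x) \<and> (x \<noteq> 0 \<longrightarrow> g p x x > 0)) \<and>
    (\<forall>U X Y. open U \<longrightarrow> smooth_field_on A U X \<longrightarrow> smooth_field_on A U Y \<longrightarrow>
         smooth_fun_on A U (\<lambda>q. g q (X q) (Y q)))"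

text \<open>A linear connection is given by the vectors \<open>nabla p x Y\<close>, the covariant derivative of a
  vector field \<open>Y\<close>, smooth on some neighbourhood of \<open>p\<close>, along a tangent vector \<open>x\<close> at \<open>p\<close>.
  Since \<open>f\<close> in the Leibniz rule need only be smooth near \<open>p\<close>, the rule forces \<open>nabla p x Y\<close>
  to depend on the germ of \<open>Y\<close> at \<open>p\<close> only.\<close>

definition linear_connection ::
    "('m::topological_space, 'e::euclidean_space) chart set
      \<Rightarrow> ('m \<Rightarrow> ('m, 'e) tvec \<Rightarrow> ('m \<Rightarrow> ('m, 'e) tvec) \<Rightarrow> ('m, 'e) tvec) \<Rightarrow> bool"
  where "linear_connection A nabla \<longleftrightarrow>
    (\<forall>U X Y. open U \<longrightarrow> smooth_field_on A U X \<longrightarrow> smooth_field_on A U Y \<longrightarrow>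
       smooth_field_on A U (\<lambda>q. nabla q (X q) Y)) \<and>
    (\<forall>U p Y. open U \<longrightarrow> p \<in> U \<longrightarrow> smooth_field_on A U Y \<longrightarrow>
       linear_within (tangent_space A p) (\<lambda>x. nabla p x Y) \<and>
       (\<forall>x\<in>tangent_space A p. nabla p x Y \<in> tangent_space A p)) \<and>
    (\<forall>U p x Y Z. open U \<longrightarrow> p \<in> U \<longrightarrow> x \<in> tangent_space A p \<longrightarrow>
       smooth_field_on A U Y \<longrightarrow> smooth_field_on A U Z \<longrightarrow>
       nabla p x (\<lambda>q. Y q + Z q) = nabla p x Y + nabla p x Z) \<and>
    (\<forall>U p x f Y. open U \<longrightarrow> p \<in> U \<longrightarrow> x \<in> tangent_space A p \<longrightarrow>
       smooth_fun_on A U f \<longrightarrow> smooth_field_on A U Y \<longrightarrow>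
       nabla p x (\<lambda>q. f q *\<^sub>R Y q) = deriv_along A p x f *\<^sub>R Y p + f p *\<^sub>R nabla p x Y)"

definition levi_civita ::
    "('m::topological_space, 'e::euclidean_space) chart set
      \<Rightarrow> ('m \<Rightarrow> ('m, 'e) tvec \<Rightarrow> ('m, 'e) tvec \<Rightarrow> real)
      \<Rightarrow> ('m \<Rightarrow> ('m, 'e) tvec \<Rightarrow> ('m \<Rightarrow> ('m, 'e) tvec) \<Rightarrow> ('m, 'e) tvec) \<Rightarrow> bool"
  where "levi_civita A g nabla \<longleftrightarrow> linear_connection A nabla \<and>
    (\<forall>U p X Y. open U \<longrightarrow> p \<in> U \<longrightarrow> smooth_field_on A U X \<longrightarrow> smooth_field_on A U Y \<longrightarrow>
       nabla p (X p) Y - nabla p (Y p) X = lie_bracket A X Y p) \<and>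
    (\<forall>U p x Y Z. open U \<longrightarrow> p \<in> U \<longrightarrow> x \<in> tangent_space A p \<longrightarrow>
       smooth_field_on A U Y \<longrightarrow> smooth_field_on A U Z \<longrightarrow>
       deriv_along A p x (\<lambda>q. g q (Y q) (Z q)) = g p (nabla p x Y) (Z p) + g p (Y p) (nabla p x Z))"

text \<open>\<open>(\<nabla>\<^sub>x \<phi>) y = \<nabla>\<^sub>x (\<phi> Y) - \<phi> (\<nabla>\<^sub>x Y)\<close> for any vector field \<open>Y\<close>, smooth
  near \<open>p\<close>, that extends \<open>y\<close>; by the Leibniz rule the choice of \<open>Y\<close> does not matter.\<close>

definition cov_deriv_endo ::
    "('m::topological_space, 'e::euclidean_space) chart set
      \<Rightarrow> ('m \<Rightarrow> ('m, 'e) tvec \<Rightarrow> ('m \<Rightarrow> ('m, 'e) tvec) \<Rightarrow> ('m, 'e) tvec)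
      \<Rightarrow> ('m \<Rightarrow> ('m, 'e) tvec \<Rightarrow> ('m, 'e) tvec)
      \<Rightarrow> 'm \<Rightarrow> ('m, 'e) tvec \<Rightarrow> ('m, 'e) tvec \<Rightarrow> ('m, 'e) tvec"
  where "cov_deriv_endo A nabla \<phi> p x y =
    (let Y = (SOME Y. Y p = y \<and> (\<exists>U. open U \<and> p \<in> U \<and> smooth_field_on A U Y)) in
       nabla p x (\<lambda>q. \<phi> q (Y q)) - \<phi> p (nabla p x Y))"

definition apapR_manifold ::
    "nat \<Rightarrow> ('m::{t2_space, second_countable_topology}, 'e::euclidean_space) chart set
      \<Rightarrow> ('m \<Rightarrow> ('m, 'e) tvec \<Rightarrow> ('m, 'e) tvec) \<Rightarrow> ('m \<Rightarrow> ('m, 'e) tvec)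
      \<Rightarrow> ('m \<Rightarrow> ('m, 'e) tvec \<Rightarrow> real)
      \<Rightarrow> ('m \<Rightarrow> ('m, 'e) tvec \<Rightarrow> ('m, 'e) tvec \<Rightarrow> real) \<Rightarrow> bool"
  where "apapR_manifold n A \<phi> \<xi> \<eta> g \<longleftrightarrow>
    n \<ge> 1 \<and> DIM('e) = 2 * n + 1 \<and> smooth_atlas A \<and>
    endomorphism_field A \<phi> \<and> smooth_field_on A UNIV \<xi> \<and> one_form A \<eta> \<and> riemannian_metric A g \<and>
    (\<forall>p. \<phi> p (\<xi> p) = 0 \<and> \<eta> p (\<xi> p) = 1 \<and> trace_within (tangent_space A p) (\<phi> p) = 0 \<and>
      (\<forall>x\<in>tangent_space A p.
         \<phi> p (\<phi> p x) = x - \<eta> p x *\<^sub>R \<xi> p \<and> \<eta> p (\<phi> p x) = 0 \<and> g p x (\<xi> p) = \<eta> p x \<and>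
         (\<forall>y\<in>tangent_space A p. g p (\<phi> p x) (\<phi> p y) = g p x y - \<eta> p x * \<eta> p y)))"

definition fundamental_tensor ::
    "('m::topological_space, 'e::euclidean_space) chart set
      \<Rightarrow> ('m \<Rightarrow> ('m, 'e) tvec \<Rightarrow> ('m \<Rightarrow> ('m, 'e) tvec) \<Rightarrow> ('m, 'e) tvec)
      \<Rightarrow> ('m \<Rightarrow> ('m, 'e) tvec \<Rightarrow> ('m, 'e) tvec)
      \<Rightarrow> ('m \<Rightarrow> ('m, 'e) tvec \<Rightarrow> ('m, 'e) tvec \<Rightarrow> real)
      \<Rightarrow> 'm \<Rightarrow> ('m, 'e) tvec \<Rightarrow> ('m, 'e) tvec \<Rightarrow> ('m, 'e) tvec \<Rightarrow> real"
  where "fundamental_tensor A nabla \<phi> g p x y z = g p (cov_deriv_endo A nabla \<phi> p x y) z"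

text \<open>In the definitions below \<open>\<phi>\<close>, \<open>\<xi>\<close>, \<open>\<eta>\<close>, \<open>g\<close>, \<open>F\<close> are the values of the tensors at one point.\<close>

definition orthonormal_basis ::
    "('v::real_vector \<Rightarrow> 'v \<Rightarrow> real) \<Rightarrow> 'v set \<Rightarrow> nat set \<Rightarrow> (nat \<Rightarrow> 'v) \<Rightarrow> bool"
  where "orthonormal_basis g V I e \<longleftrightarrow> e ` I \<subseteq> V \<and> span (e ` I) = V \<and>
    (\<forall>i\<in>I. \<forall>j\<in>I. g (e i) (e j) = (if i = j then 1 else 0))"

text \<open>The Lee forms, computed with a basis \<open>e\<close> that is meant to be orthonormal in \<open>ker \<eta>\<close>.\<close>

definition lee_theta :: "nat \<Rightarrow> (nat \<Rightarrow> 'v) \<Rightarrow> ('v \<Rightarrow> 'v \<Rightarrow> 'v \<Rightarrow> real) \<Rightarrow> 'v \<Rightarrow> real"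
  where "lee_theta n e F z = (\<Sum>i = 1..2 * n. F (e i) (e i) z)"

definition lee_theta_star ::
    "nat \<Rightarrow> (nat \<Rightarrow> 'v) \<Rightarrow> ('v \<Rightarrow> 'v) \<Rightarrow> ('v \<Rightarrow> 'v \<Rightarrow> 'v \<Rightarrow> real) \<Rightarrow> 'v \<Rightarrow> real"
  where "lee_theta_star n e \<phi> F z = (\<Sum>i = 1..2 * n. F (e i) (\<phi> (e i)) z)"

definition lee_omega :: "'v \<Rightarrow> ('v \<Rightarrow> 'v \<Rightarrow> 'v \<Rightarrow> real) \<Rightarrow> 'v \<Rightarrow> real"
  where "lee_omega \<xi> F z = F \<xi> \<xi> z"

definition bracket :: "('v \<Rightarrow> real) \<Rightarrow> ('v \<Rightarrow> 'v \<Rightarrow> real) \<Rightarrow> 'v \<Rightarrow> 'v \<Rightarrow> 'v \<Rightarrow> real"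
  where "bracket \<eta> S x y z = S x y * \<eta> z + S x z * \<eta> y"

definition b_form ::
    "('v \<Rightarrow> 'v) \<Rightarrow> 'v \<Rightarrow> ('v \<Rightarrow> 'v \<Rightarrow> 'v \<Rightarrow> real) \<Rightarrow> 'v \<Rightarrow> 'v \<Rightarrow> real"
  where "b_form \<phi> \<xi> F x y = F (\<phi> (\<phi> x)) (\<phi> (\<phi> y)) \<xi>"

definition c_form ::
    "('v \<Rightarrow> 'v) \<Rightarrow> 'v \<Rightarrow> ('v \<Rightarrow> 'v \<Rightarrow> 'v \<Rightarrow> real) \<Rightarrow> 'v \<Rightarrow> 'v \<Rightarrow> real"
  where "c_form \<phi> \<xi> F x y = F (\<phi> x) (\<phi> y) \<xi>"

definition F1_comp ::
    "nat \<Rightarrow> ('v \<Rightarrow> 'v) \<Rightarrow> ('v \<Rightarrow> 'v \<Rightarrow> real) \<Rightarrow> ('v \<Rightarrow> real) \<Rightarrow> 'v \<Rightarrow> 'v \<Rightarrow> 'v \<Rightarrow> real"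
  where "F1_comp n \<phi> g \<theta> x y z = 1 / (2 * real n) *
    (g (\<phi> x) (\<phi> y) * \<theta> (\<phi> (\<phi> z)) + g (\<phi> x) (\<phi> z) * \<theta> (\<phi> (\<phi> y))
     - g x (\<phi> y) * \<theta> (\<phi> z) - g x (\<phi> z) * \<theta> (\<phi> y))"

definition F2_comp ::
    "nat \<Rightarrow> ('v \<Rightarrow> 'v) \<Rightarrow> ('v \<Rightarrow> 'v \<Rightarrow> real) \<Rightarrow> ('v \<Rightarrow> real) \<Rightarrow> ('v \<Rightarrow> 'v \<Rightarrow> 'v \<Rightarrow> real)
      \<Rightarrow> 'v \<Rightarrow> 'v \<Rightarrow> 'v \<Rightarrow> real"
  where "F2_comp n \<phi> g \<theta> F x y z = 1 / 4 *
    (2 * F (\<phi> (\<phi> x)) (\<phi> (\<phi> y)) (\<phi> (\<phi> z))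
     + F (\<phi> (\<phi> y)) (\<phi> (\<phi> z)) (\<phi> (\<phi> x)) + F (\<phi> (\<phi> z)) (\<phi> (\<phi> x)) (\<phi> (\<phi> y))
     - F (\<phi> y) (\<phi> z) (\<phi> (\<phi> x)) - F (\<phi> z) (\<phi> y) (\<phi> (\<phi> x)))
    - F1_comp n \<phi> g \<theta> x y z"

definition F3_comp ::
    "('v \<Rightarrow> 'v) \<Rightarrow> ('v \<Rightarrow> 'v \<Rightarrow> 'v \<Rightarrow> real) \<Rightarrow> 'v \<Rightarrow> 'v \<Rightarrow> 'v \<Rightarrow> real"
  where "F3_comp \<phi> F x y z = 1 / 4 *
    (2 * F (\<phi> (\<phi> x)) (\<phi> (\<phi> y)) (\<phi> (\<phi> z))
     - F (\<phi> (\<phi> y)) (\<phi> (\<phi> z)) (\<phi> (\<phi> x)) - F (\<phi> (\<phi> z)) (\<phi> (\<phi> x)) (\<phi> (\<phi> y))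
     + F (\<phi> y) (\<phi> z) (\<phi> (\<phi> x)) + F (\<phi> z) (\<phi> y) (\<phi> (\<phi> x)))"

definition F4_comp ::
    "nat \<Rightarrow> ('v \<Rightarrow> 'v) \<Rightarrow> 'v \<Rightarrow> ('v \<Rightarrow> real) \<Rightarrow> ('v \<Rightarrow> 'v \<Rightarrow> real) \<Rightarrow> ('v \<Rightarrow> real)
      \<Rightarrow> 'v \<Rightarrow> 'v \<Rightarrow> 'v \<Rightarrow> real"
  where "F4_comp n \<phi> \<xi> \<eta> g \<theta> x y z =
    \<theta> \<xi> / (2 * real n) * bracket \<eta> (\<lambda>x y. g (\<phi> x) (\<phi> y)) x y z"

definition F5_comp ::
    "nat \<Rightarrow> ('v \<Rightarrow> 'v) \<Rightarrow> 'v \<Rightarrow> ('v \<Rightarrow> real) \<Rightarrow> ('v \<Rightarrow> 'v \<Rightarrow> real) \<Rightarrow> ('v \<Rightarrow> real)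
      \<Rightarrow> 'v \<Rightarrow> 'v \<Rightarrow> 'v \<Rightarrow> real"
  where "F5_comp n \<phi> \<xi> \<eta> g \<theta>s x y z =
    \<theta>s \<xi> / (2 * real n) * bracket \<eta> (\<lambda>x y. g x (\<phi> y)) x y z"

definition F6_comp ::
    "nat \<Rightarrow> ('v \<Rightarrow> 'v) \<Rightarrow> 'v \<Rightarrow> ('v \<Rightarrow> real) \<Rightarrow> ('v \<Rightarrow> 'v \<Rightarrow> real) \<Rightarrow> ('v \<Rightarrow> real) \<Rightarrow> ('v \<Rightarrow> real)
      \<Rightarrow> ('v \<Rightarrow> 'v \<Rightarrow> 'v \<Rightarrow> real) \<Rightarrow> 'v \<Rightarrow> 'v \<Rightarrow> 'v \<Rightarrow> real"
  where "F6_comp n \<phi> \<xi> \<eta> g \<theta> \<theta>s F x y z = 1 / 4 * bracket \<eta>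
      (\<lambda>x y. b_form \<phi> \<xi> F x y + b_form \<phi> \<xi> F y x + c_form \<phi> \<xi> F x y + c_form \<phi> \<xi> F y x) x y z
    - F4_comp n \<phi> \<xi> \<eta> g \<theta> x y z - F5_comp n \<phi> \<xi> \<eta> g \<theta>s x y z"

definition F7_comp ::
    "('v \<Rightarrow> 'v) \<Rightarrow> 'v \<Rightarrow> ('v \<Rightarrow> real) \<Rightarrow> ('v \<Rightarrow> 'v \<Rightarrow> 'v \<Rightarrow> real) \<Rightarrow> 'v \<Rightarrow> 'v \<Rightarrow> 'v \<Rightarrow> real"
  where "F7_comp \<phi> \<xi> \<eta> F x y z = 1 / 4 * bracket \<eta>
      (\<lambda>x y. b_form \<phi> \<xi> F x y - b_form \<phi> \<xi> F y x + c_form \<phi> \<xi> F x y - c_form \<phi> \<xi> F y x) x y z"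

definition F8_comp ::
    "('v \<Rightarrow> 'v) \<Rightarrow> 'v \<Rightarrow> ('v \<Rightarrow> real) \<Rightarrow> ('v \<Rightarrow> 'v \<Rightarrow> 'v \<Rightarrow> real) \<Rightarrow> 'v \<Rightarrow> 'v \<Rightarrow> 'v \<Rightarrow> real"
  where "F8_comp \<phi> \<xi> \<eta> F x y z = 1 / 4 * bracket \<eta>
      (\<lambda>x y. b_form \<phi> \<xi> F x y + b_form \<phi> \<xi> F y x - c_form \<phi> \<xi> F x y - c_form \<phi> \<xi> F y x) x y z"

definition F9_comp ::
    "('v \<Rightarrow> 'v) \<Rightarrow> 'v \<Rightarrow> ('v \<Rightarrow> real) \<Rightarrow> ('v \<Rightarrow> 'v \<Rightarrow> 'v \<Rightarrow> real) \<Rightarrow> 'v \<Rightarrow> 'v \<Rightarrow> 'v \<Rightarrow> real"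
  where "F9_comp \<phi> \<xi> \<eta> F x y z = 1 / 4 * bracket \<eta>
      (\<lambda>x y. b_form \<phi> \<xi> F x y - b_form \<phi> \<xi> F y x - c_form \<phi> \<xi> F x y + c_form \<phi> \<xi> F y x) x y z"

definition F10_comp ::
    "('v \<Rightarrow> 'v) \<Rightarrow> 'v \<Rightarrow> ('v \<Rightarrow> real) \<Rightarrow> ('v \<Rightarrow> 'v \<Rightarrow> 'v \<Rightarrow> real) \<Rightarrow> 'v \<Rightarrow> 'v \<Rightarrow> 'v \<Rightarrow> real"
  where "F10_comp \<phi> \<xi> \<eta> F x y z = \<eta> x * F \<xi> (\<phi> (\<phi> y)) (\<phi> (\<phi> z))"

definition F11_comp ::
    "('v \<Rightarrow> real) \<Rightarrow> ('v \<Rightarrow> real) \<Rightarrow> 'v \<Rightarrow> 'v \<Rightarrow> 'v \<Rightarrow> real"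
  where "F11_comp \<eta> \<omega> x y z = \<eta> x * (\<eta> y * \<omega> z + \<eta> z * \<omega> y)"

end

theory Submission
  imports Defs
begin

text \<open>At one point everything is linear algebra. In the frame \<open>e\<^sub>0 = \<xi>\<close>, \<open>e\<^sub>1\<close>, \<open>e\<^sub>2 = \<phi> e\<^sub>1\<close> the map \<open>\<phi>\<close>
  kills \<open>e\<^sub>0\<close> and exchanges \<open>e\<^sub>1\<close> and \<open>e\<^sub>2\<close>, so the symmetries
  \<open>F(x, y, z) = F(x, z, y)\<close> and
  \<open>F(x, \<phi>y, \<phi>z) = - F(x, y, z) + \<eta>(y) F(x, \<xi>, z) + \<eta>(z) F(x, y, \<xi>)\<close>
  leave only \<open>F\<^sub>i\<^sub>1\<^sub>0\<close>, \<open>F\<^sub>i\<^sub>2\<^sub>0\<close> and \<open>F\<^sub>i\<^sub>1\<^sub>1 = - F\<^sub>i\<^sub>2\<^sub>2\<close> (lemmas \<open>F_frame\<close>, \<open>F_vec\<close>). The Lee forms are traces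
  over \<open>ker \<eta>\<close>, so they may be computed with \<open>e\<^sub>1, e\<^sub>2\<close> (\<open>trace_ker_eta\<close>). Substituting coordinates
  into the definitions of the components then leaves polynomial identities.

  What has to be proved about the manifold is that \<open>F\<close> is trilinear on the tangent space and has
  these two symmetries. The map \<open>\<phi>\<close> is self-adjoint for \<open>g\<close>; differentiating \<open>g(\<phi>Y, Z) = g(Y, \<phi>Z)\<close>
  with the metric connection shows that \<open>\<nabla>\<^sub>x \<phi>\<close> is self-adjoint as well (\<open>nabla_phi_selfadjoint\<close>).
  This single identity yields three things: \<open>(\<nabla>\<^sub>x \<phi>) Y\<close> depends on the value of \<open>Y\<close> at the
  point only, because the other side of the identity does; \<open>F\<close> is symmetric in its last two arguments; and \<open>F\<close> is therefore
  linear in the second argument because it is linear in the third. The other symmetry comes from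
  differentiating \<open>\<phi>\<^sup>2 = I - \<eta> \<otimes> \<xi>\<close> (\<open>nabla_phi_anticommute\<close>, \<open>F_phi_phi\<close>).

  The argument needs vector fields with prescribed value at the point. They are the fields with
  constant coordinates in a chart (\<open>smooth_extension_exists\<close>); that they are smooth in all other
  charts rests on the closure of \<open>C\<^sup>k\<close> maps under products and compositions.\<close>

section \<open>Calculus of \<open>C\<^sup>k\<close> maps\<close>

lemma Ck_on_subset: "Ck_on k S f \<Longrightarrow> T \<subseteq> S \<Longrightarrow> Ck_on k T f"
  by (induction k arbitrary: f) (auto intro: continuous_on_subset)

lemma
  assumes "open S" "u \<in> S" "\<And>v. v \<in> S \<Longrightarrow> f v = f' v"
  shows differentiable_cong_open: "f differentiable (at u) \<longleftrightarrow> f' differentiable (at u)"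
    and frechet_derivative_cong_open: "frechet_derivative f (at u) = frechet_derivative f' (at u)"
proof -
  have "(f has_derivative D) (at u) \<longleftrightarrow> (f' has_derivative D) (at u)" for D
    using assms by (metis has_derivative_transform_within_open)
  then show "f differentiable (at u) \<longleftrightarrow> f' differentiable (at u)"
    "frechet_derivative f (at u) = frechet_derivative f' (at u)"
    by (auto simp: differentiable_def frechet_derivative_def)
qed

lemma Ck_on_cong:
  assumes "open S" "\<And>u. u \<in> S \<Longrightarrow> f u = f' u"
  shows "Ck_on k S f \<longleftrightarrow> Ck_on k S f'"
  using assms(2)
proof (induction k arbitrary: f f')
  case 0
  then show ?case by (simp cong: continuous_on_cong)
next
  case (Suc k)
  have "f differentiable (at u) \<longleftrightarrow> f' differentiable (at u)" if "u \<in> S" for u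
    using assms(1) that Suc.prems by (rule differentiable_cong_open)
  moreover have "Ck_on k S (\<lambda>u. frechet_derivative f (at u) w)
      \<longleftrightarrow> Ck_on k S (\<lambda>u. frechet_derivative f' (at u) w)" for w
  proof (rule Suc.IH)
    fix u assume "u \<in> S"
    have "frechet_derivative f (at u) = frechet_derivative f' (at u)"
      using assms(1) \<open>u \<in> S\<close> Suc.prems by (rule frechet_derivative_cong_open)
    then show "frechet_derivative f (at u) w = frechet_derivative f' (at u) w"
      by simp
  qed
  ultimately show ?case
    by simp
qed

lemma Ck_on_Suc_imp_Ck_on: "Ck_on (Suc k) S f \<Longrightarrow> Ck_on k S f"
proof (induction k arbitrary: f)
  case 0
  then show ?case
    by (auto intro!: continuous_at_imp_continuous_on differentiable_imp_continuous_within)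
next
  case (Suc k)
  then show ?case by (metis Ck_on.simps(2))
qed

lemma Ck_on_imp_differentiable:
  "Ck_on (Suc k) S f \<Longrightarrow> u \<in> S \<Longrightarrow> (f has_derivative frechet_derivative f (at u)) (at u)"
  by (simp add: frechet_derivative_works)

text \<open>The recursion behind \<open>C\<^sup>k\<close> runs through \<open>frechet_derivative\<close>. The closure
  properties below compute a derivative \<open>D\<close> by hand and feed it back into the recursion by this rule.\<close>

lemma Ck_on_SucI:
  assumes "open S" and D: "\<And>u. u \<in> S \<Longrightarrow> (f has_derivative D u) (at u)"
    and "\<And>w. Ck_on k S (\<lambda>u. D u w)"
  shows "Ck_on (Suc k) S f"
proof -
  have "Ck_on k S (\<lambda>u. frechet_derivative f (at u) w) \<longleftrightarrow> Ck_on k S (\<lambda>u. D u w)" for w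
    by (rule Ck_on_cong[OF assms(1)]) (simp add: frechet_derivative_at[OF D, symmetric])
  then have "Ck_on k S (\<lambda>u. frechet_derivative f (at u) w)" for w
    using assms(3) by simp
  moreover have "f differentiable (at u)" if "u \<in> S" for u
    using D[OF that] by (rule differentiableI)
  ultimately show ?thesis
    by simp
qed

lemma Ck_on_const: "open S \<Longrightarrow> Ck_on k S (\<lambda>u. a)"
proof (induction k arbitrary: a)
  case (Suc k)
  then show ?case by (intro Ck_on_SucI[OF _ has_derivative_const])
qed simp

lemma Ck_on_add:
  assumes "open S" "Ck_on k S f" "Ck_on k S h"
  shows "Ck_on k S (\<lambda>u. f u + h u)"
  using assms(2,3)
proof (induction k arbitrary: f h)
  case 0
  then show ?case by (simp add: continuous_on_add)
next
  case (Suc k)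
  let ?D = "\<lambda>u w. frechet_derivative f (at u) w + frechet_derivative h (at u) w"
  have has: "((\<lambda>u. f u + h u) has_derivative ?D u) (at u)" if "u \<in> S" for u
    using Ck_on_imp_differentiable[OF Suc.prems(1) that]
      Ck_on_imp_differentiable[OF Suc.prems(2) that] by (rule has_derivative_add)
  have "Ck_on k S (\<lambda>u. ?D u w)" for w
    using Suc by simp
  then show ?case
    using has by (intro Ck_on_SucI[OF assms(1)])
qed

lemma Ck_on_sum:
  assumes "open S" "\<And>i. i \<in> I \<Longrightarrow> Ck_on k S (f i)"
  shows "Ck_on k S (\<lambda>u. \<Sum>i\<in>I. f i u)"
  using assms(2)
  by (induction I rule: infinite_finite_induct) (auto intro: Ck_on_const[OF assms(1)] Ck_on_add[OF assms(1)])

text \<open>By the product rule the derivative is a sum of two products, each of a function and a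
  derivative of one order less, so both fall under the induction hypothesis.\<close>

lemma Ck_on_bilinear:
  assumes "bounded_bilinear B" "open S" "Ck_on k S f" "Ck_on k S h"
  shows "Ck_on k S (\<lambda>u. B (f u) (h u))"
  using assms(3,4)
proof (induction k arbitrary: f h)
  case 0
  then show ?case by (simp add: bounded_bilinear.continuous_on[OF assms(1)])
next
  case (Suc k)
  let ?D = "\<lambda>u w. B (f u) (frechet_derivative h (at u) w) + B (frechet_derivative f (at u) w) (h u)"
  have has: "((\<lambda>u. B (f u) (h u)) has_derivative ?D u) (at u)" if "u \<in> S" for u
    using Ck_on_imp_differentiable[OF Suc.prems(1) that]
      Ck_on_imp_differentiable[OF Suc.prems(2) that]
    by (rule bounded_bilinear.FDERIV[OF assms(1)])
  have "Ck_on k S (\<lambda>u. ?D u w)" for w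
    using Suc.prems(1)[THEN Ck_on_Suc_imp_Ck_on] Suc.prems(2)[THEN Ck_on_Suc_imp_Ck_on] Suc.prems
    by (intro Ck_on_add[OF assms(2)] Suc.IH) auto
  then show ?case
    using has by (intro Ck_on_SucI[OF assms(2)])
qed

text \<open>Expanding \<open>Df(u) w\<close> in the standard basis turns the chain rule into
  \<open>\<Sum>\<^sub>i (Df(u) w \<bullet> i) \<cdot> (D\<^sub>i h)(f u)\<close>, a sum of products in which the \<open>D\<^sub>i h\<close> are fixed functions
  of class \<open>C\<^sup>k\<close>; the induction hypothesis therefore applies to \<open>(D\<^sub>i h) \<circ> f\<close>.\<close>

lemma Ck_on_compose:
  fixes f :: "'a::euclidean_space \<Rightarrow> 'b::euclidean_space"
  assumes "open S" "f ` S \<subseteq> T" "Ck_on k S f" "Ck_on k T h"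
  shows "Ck_on k S (\<lambda>u. h (f u))"
  using assms(3,4)
proof (induction k arbitrary: h)
  case 0
  then show ?case using assms(2) by (auto intro: continuous_on_compose2)
next
  case (Suc k)
  let ?D = "\<lambda>u w. \<Sum>i\<in>Basis. (frechet_derivative f (at u) w \<bullet> i) *\<^sub>R frechet_derivative h (at (f u)) i"
  have has: "((\<lambda>u. h (f u)) has_derivative ?D u) (at u)" if "u \<in> S" for u
  proof -
    have h: "(h has_derivative frechet_derivative h (at (f u))) (at (f u))"
      using Suc.prems(2) assms(2) that by (intro Ck_on_imp_differentiable) auto
    then interpret h: linear "frechet_derivative h (at (f u))"
      by (rule has_derivative_linear)
    have D: "(\<lambda>w. frechet_derivative h (at (f u)) (frechet_derivative f (at u) w)) = ?D u"
    proof
      fix w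
      let ?v = "frechet_derivative f (at u) w"
      have "frechet_derivative h (at (f u)) (\<Sum>i\<in>Basis. (?v \<bullet> i) *\<^sub>R i)
          = (\<Sum>i\<in>Basis. (?v \<bullet> i) *\<^sub>R frechet_derivative h (at (f u)) i)"
        by (simp only: h.sum h.scale)
      then show "frechet_derivative h (at (f u)) ?v = ?D u w"
        by (simp only: euclidean_representation)
    qed
    show ?thesis
      using has_derivative_compose[OF Ck_on_imp_differentiable[OF Suc.prems(1) that] h]
      by (simp only: D)
  qed
  have "Ck_on k S (\<lambda>u. ?D u w)" for w
  proof (intro Ck_on_sum[OF assms(1)] Ck_on_bilinear[OF bounded_bilinear_scaleR assms(1)]
      Ck_on_bilinear[OF bounded_bilinear_inner assms(1)] Ck_on_const[OF assms(1)])
    show "Ck_on k S (\<lambda>u. frechet_derivative f (at u) w)"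
      using Suc.prems by simp
    show "Ck_on k S (\<lambda>u. frechet_derivative h (at (f u)) i)" for i
      using Suc.prems(1)[THEN Ck_on_Suc_imp_Ck_on] Suc.prems(2) by (intro Suc.IH) auto
  qed
  then show ?case
    using has by (intro Ck_on_SucI[OF assms(1)])
qed

section \<open>Tangent vectors and their smooth extensions\<close>

lemma smooth_on_subset: "smooth_on S f \<Longrightarrow> T \<subseteq> S \<Longrightarrow> smooth_on T f"
  by (auto simp: smooth_on_def intro: Ck_on_subset)

lemma smooth_field_on_subset:
  "smooth_field_on A U X \<Longrightarrow> W \<subseteq> U \<Longrightarrow> smooth_field_on A W X"
  unfolding smooth_field_on_def by (blast intro: smooth_on_subset)

lemma open_chart_image:
  assumes c: "is_chart c" and "open U"
  shows "open (snd c ` (U \<inter> fst c))"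
proof -
  obtain h where h: "homeomorphism (fst c) (snd c ` fst c) (snd c) h"
    and "open (snd c ` fst c)"
    using c by (auto simp: is_chart_def)
  have "openin (top_of_set (fst c)) (U \<inter> fst c)"
    using \<open>open U\<close> openin_open_Int[of U "fst c"] by (simp add: Int_commute)
  then have "openin (top_of_set (snd c ` fst c)) (snd c ` (U \<inter> fst c))"
    using homeomorphism_imp_open_map[OF h] by blast
  then show ?thesis
    using \<open>open (snd c ` fst c)\<close> by (rule openin_open_trans)
qed

lemma open_chart_domain: "is_chart c \<Longrightarrow> open (fst c)"
  by (simp add: is_chart_def)

lemma chart_inv_chart: "is_chart c \<Longrightarrow> q \<in> fst c \<Longrightarrow> chart_inv c (snd c q) = q"
proof -
  assume "is_chart c" and q: "q \<in> fst c"
  then obtain h where "homeomorphism (fst c) (snd c ` fst c) (snd c) h"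
    by (auto simp: is_chart_def)
  then have "inj_on (snd c) (fst c)"
    by (intro inj_on_inverseI homeomorphism_apply1)
  then show "chart_inv c (snd c q) = q"
    using q unfolding chart_inv_def by (rule inv_into_f_f)
qed

lemma tangent_spaceI:
  assumes "\<And>c. c \<notin> charts_at A q \<Longrightarrow> v c = 0"
    and "\<And>c c'. c \<in> charts_at A q \<Longrightarrow> c' \<in> charts_at A q \<Longrightarrow>
      v c' = frechet_derivative (transition c c') (at (snd c q)) (v c)"
  shows "v \<in> tangent_space A q"
  using assms unfolding tangent_space_def by blast

lemma tangent_space_transform:
  assumes "v \<in> tangent_space A q" "c \<in> charts_at A q" "c' \<in> charts_at A q"
  shows "v c' = frechet_derivative (transition c c') (at (snd c q)) (v c)"
  using assms unfolding tangent_space_def by blast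

lemma tangent_space_outside: "v \<in> tangent_space A q \<Longrightarrow> c \<notin> charts_at A q \<Longrightarrow> v c = 0"
  unfolding tangent_space_def by blast

context
  fixes A :: "('m::{t2_space, second_countable_topology}, 'e::euclidean_space) chart set"
  assumes atlas: "smooth_atlas A"
begin

lemma charts_at_is_chart: "c \<in> charts_at A q \<Longrightarrow> is_chart c"
  using atlas by (auto simp: smooth_atlas_def charts_at_def)

lemma transition_has_derivative:
  assumes "c \<in> charts_at A q" "c' \<in> charts_at A q"
  shows "(transition c c' has_derivative frechet_derivative (transition c c') (at (snd c q)))
           (at (snd c q))"
proof (rule Ck_on_imp_differentiable)
  show "Ck_on (Suc 0) (snd c ` (fst c \<inter> fst c')) (transition c c')"
    using atlas assms unfolding smooth_atlas_def charts_at_def smooth_on_def by blast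
qed (use assms in \<open>auto simp: charts_at_def\<close>)

text \<open>The chain rule for \<open>c \<rightarrow> c' \<rightarrow> c''\<close>: the contravariant transformation law is consistent,
  so the values in one chart determine a tangent vector.\<close>

lemma transition_cocycle:
  assumes "c \<in> charts_at A q" "c' \<in> charts_at A q" "c'' \<in> charts_at A q"
  shows "frechet_derivative (transition c c'') (at (snd c q)) w =
    frechet_derivative (transition c' c'') (at (snd c' q))
      (frechet_derivative (transition c c') (at (snd c q)) w)"
proof -
  let ?S = "snd c ` (fst c \<inter> fst c')"
  have charts: "is_chart c" "is_chart c'" "q \<in> fst c" "q \<in> fst c'"
    using charts_at_is_chart[OF assms(1)] charts_at_is_chart[OF assms(2)] assms by (auto simp: charts_at_def)
  have S: "open ?S" "snd c q \<in> ?S"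
    using charts open_chart_image[of c "fst c'"] open_chart_domain[of c'] by (auto simp: Int_commute)
  have q: "transition c c' (snd c q) = snd c' q"
    using charts by (simp add: transition_def chart_inv_chart)
  have "((\<lambda>u. transition c' c'' (transition c c' u)) has_derivative
      (\<lambda>w. frechet_derivative (transition c' c'') (at (snd c' q))
        (frechet_derivative (transition c c') (at (snd c q)) w))) (at (snd c q))"
    using has_derivative_compose[OF transition_has_derivative[OF assms(1,2)], of "transition c' c''"]
      transition_has_derivative[OF assms(2,3)] q by simp
  moreover note S
  moreover have "transition c' c'' (transition c c' u) = transition c c'' u" if "u \<in> ?S" for u
    using that charts by (auto simp: transition_def chart_inv_chart)
  ultimately have "(transition c c'' has_derivative
      (\<lambda>w. frechet_derivative (transition c' c'') (at (snd c' q))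
        (frechet_derivative (transition c c') (at (snd c q)) w))) (at (snd c q))"
    by (rule has_derivative_transform_within_open)
  from fun_cong[OF frechet_derivative_at[OF this], of w] show ?thesis
    by (rule sym)
qed

lemma subspace_tangent_space: "subspace (tangent_space A q)"
proof (rule subspaceI)
  let ?D = "\<lambda>c c'. frechet_derivative (transition c c') (at (snd c q))"
  have lin: "linear (?D c c')" if "c \<in> charts_at A q" "c' \<in> charts_at A q" for c c'
    using transition_has_derivative[OF that] by (rule has_derivative_linear)
  show "0 \<in> tangent_space A q"
    by (rule tangent_spaceI) (simp_all add: linear_0[OF lin])
  show "v + w \<in> tangent_space A q" if vw: "v \<in> tangent_space A q" "w \<in> tangent_space A q" for v w
  proof (rule tangent_spaceI)
    fix c c' assume c: "c \<in> charts_at A q" "c' \<in> charts_at A q"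
    show "(v + w) c' = ?D c c' ((v + w) c)"
      using tangent_space_transform[OF vw(1) c] tangent_space_transform[OF vw(2) c]
      by (simp add: linear_add[OF lin[OF c]])
  qed (simp add: vw[THEN tangent_space_outside])
  show "a *\<^sub>R v \<in> tangent_space A q" if v: "v \<in> tangent_space A q" for a v
  proof (rule tangent_spaceI)
    fix c c' assume c: "c \<in> charts_at A q" "c' \<in> charts_at A q"
    show "(a *\<^sub>R v) c' = ?D c c' ((a *\<^sub>R v) c)"
      using tangent_space_transform[OF v c] by (simp add: scaleR_fun_def linear_scale[OF lin[OF c]])
  qed (simp add: tangent_space_outside[OF v] scaleR_fun_def)
qed

text \<open>A smooth field need be tangent only near the point, so identities between fields, such as the
  self-adjointness of \<open>\<phi>\<close>, hold only there; this rule lets them be differentiated.\<close>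

lemma deriv_along_cong:
  assumes "open U" "p \<in> U" "\<And>q. q \<in> U \<Longrightarrow> f q = f' q"
  shows "deriv_along A p x f = deriv_along A p x f'"
proof -
  define c where "c = (SOME c. c \<in> charts_at A p)"
  have "\<exists>c. c \<in> charts_at A p"
  proof -
    have "p \<in> \<Union> (fst ` A)"
      using atlas by (simp add: smooth_atlas_def)
    then show ?thesis
      unfolding charts_at_def by blast
  qed
  then have c: "c \<in> charts_at A p"
    unfolding c_def by (rule someI_ex)
  let ?S = "snd c ` (U \<inter> fst c)"
  have "is_chart c" "p \<in> fst c"
    using c charts_at_is_chart[OF c] by (auto simp: charts_at_def)
  then have "open ?S" "snd c p \<in> ?S"
    using assms by (auto intro!: open_chart_image)
  moreover have "f (chart_inv c u) = f' (chart_inv c u)" if "u \<in> ?S" for u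
    using that assms(3) \<open>is_chart c\<close> by (auto simp: chart_inv_chart)
  ultimately have "frechet_derivative (\<lambda>u. f (chart_inv c u)) (at (snd c p))
      = frechet_derivative (\<lambda>u. f' (chart_inv c u)) (at (snd c p))"
    by (rule frechet_derivative_cong_open)
  then show ?thesis
    unfolding deriv_along_def c_def[symmetric] Let_def by simp
qed

text \<open>In a chart \<open>c\<close> around \<open>p\<close> take the field with constant coordinate vector \<open>v c\<close>, and \<open>0\<close> off
  the chart domain. In another chart it reads \<open>(D(c' \<circ> c\<inverse>)(v c)) \<circ> (c \<circ> c'\<inverse>)\<close>, which is smooth as a
  composition. The field is tangent at every point, also where it is not smooth; identities such as
  \<open>\<phi>\<^sup>2 Y = Y - \<eta>(Y) \<xi>\<close> then hold on the whole manifold.\<close>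

lemma smooth_extension_exists:
  assumes v: "v \<in> tangent_space A p"
  obtains U V where "open U" "p \<in> U" "smooth_field_on A U V" "V p = v"
    "\<And>q. V q \<in> tangent_space A q"
proof -
  obtain c where c: "c \<in> A" "p \<in> fst c"
    using atlas unfolding smooth_atlas_def by blast
  have "is_chart c"
    using c atlas by (auto simp: smooth_atlas_def)
  define V where "V q = (\<lambda>c'. if q \<in> fst c \<and> c' \<in> charts_at A q
    then frechet_derivative (transition c c') (at (snd c q)) (v c) else 0)" for q
  have tangent: "V q \<in> tangent_space A q" for q
  proof (cases "q \<in> fst c")
    case True
    then have q: "c \<in> charts_at A q" using c by (simp add: charts_at_def)
    show ?thesis
    proof (rule tangent_spaceI)
      fix c' c'' assume "c' \<in> charts_at A q" "c'' \<in> charts_at A q"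
      then show "V q c'' = frechet_derivative (transition c' c'') (at (snd c' q)) (V q c')"
        using transition_cocycle[OF q, of c' c'' "v c"] True by (simp add: V_def)
    qed (simp add: V_def)
  next
    case False
    then have "V q = 0" by (auto simp: V_def)
    then show ?thesis using subspace_0[OF subspace_tangent_space] by simp
  qed
  have "smooth_on (snd c' ` (fst c \<inter> fst c')) (\<lambda>u. V (chart_inv c' u) c')" if c': "c' \<in> A" for c'
  proof -
    let ?S = "snd c' ` (fst c \<inter> fst c')" and ?T = "snd c ` (fst c \<inter> fst c')"
    have "is_chart c'" using c' atlas by (auto simp: smooth_atlas_def)
    have S: "open ?S"
      using \<open>is_chart c'\<close> \<open>is_chart c\<close> by (intro open_chart_image open_chart_domain)
    have "smooth_on ?T (transition c c')" "smooth_on ?S (transition c' c)"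
      using atlas c c' unfolding smooth_atlas_def by (auto simp: Int_commute)
    then have "Ck_on (Suc k) ?T (transition c c')" and "Ck_on k ?S (transition c' c)" for k
      unfolding smooth_on_def by blast+
    then have D: "Ck_on k ?T (\<lambda>u. frechet_derivative (transition c c') (at u) (v c))"
      and "Ck_on k ?S (transition c' c)" for k
      by simp_all
    moreover have "transition c' c ` ?S \<subseteq> ?T"
      using \<open>is_chart c'\<close> by (auto simp: transition_def chart_inv_chart)
    ultimately have "Ck_on k ?S
        (\<lambda>u. frechet_derivative (transition c c') (at (transition c' c u)) (v c))" for k
      using Ck_on_compose[OF S _ _ D] by simp
    moreover have "V (chart_inv c' u) c'
        = frechet_derivative (transition c c') (at (transition c' c u)) (v c)" if "u \<in> ?S" for u
      using that c' \<open>is_chart c'\<close>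
      by (auto simp: V_def transition_def chart_inv_chart charts_at_def)
    ultimately show ?thesis
      using Ck_on_cong[OF S, of "\<lambda>u. V (chart_inv c' u) c'"
          "\<lambda>u. frechet_derivative (transition c c') (at (transition c' c u)) (v c)"]
      by (simp add: smooth_on_def)
  qed
  then have "smooth_field_on A (fst c) V"
    using tangent by (simp add: smooth_field_on_def)
  moreover have "V p = v"
  proof
    have p: "c \<in> charts_at A p" using c by (simp add: charts_at_def)
    show "V p c' = v c'" for c'
      using tangent_space_transform[OF v p, of c'] tangent_space_outside[OF v, of c'] c
      by (auto simp: V_def)
  qed
  moreover have "open (fst c)"
    using \<open>is_chart c\<close> by (rule open_chart_domain)
  ultimately show ?thesis
    using that tangent c by blast
qed

end

section \<open>The covariant derivative of \<open>\<phi>\<close>\<close>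

locale levi_civita_apapR_manifold =
  fixes n :: nat
    and A :: "('m::{t2_space, second_countable_topology}, 'e::euclidean_space) chart set"
    and \<phi> :: "'m \<Rightarrow> ('m, 'e) tvec \<Rightarrow> ('m, 'e) tvec"
    and \<xi> :: "'m \<Rightarrow> ('m, 'e) tvec"
    and \<eta> :: "'m \<Rightarrow> ('m, 'e) tvec \<Rightarrow> real"
    and g :: "'m \<Rightarrow> ('m, 'e) tvec \<Rightarrow> ('m, 'e) tvec \<Rightarrow> real"
    and nabla :: "'m \<Rightarrow> ('m, 'e) tvec \<Rightarrow> ('m \<Rightarrow> ('m, 'e) tvec) \<Rightarrow> ('m, 'e) tvec"
  assumes manifold: "apapR_manifold n A \<phi> \<xi> \<eta> g"
    and connection: "levi_civita A g nabla"
begin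

lemma atlas: "smooth_atlas A"
  and phi_field: "endomorphism_field A \<phi>"
  and xi_field: "smooth_field_on A UNIV \<xi>"
  and eta_field: "one_form A \<eta>"
  and g_field: "riemannian_metric A g"
  and phi_xi: "\<phi> p (\<xi> p) = 0"
  and eta_xi: "\<eta> p (\<xi> p) = 1"
  using manifold by (auto simp: apapR_manifold_def)

lemma nabla_connection: "linear_connection A nabla"
  using connection by (simp add: levi_civita_def)

abbreviation T where "T p \<equiv> tangent_space A p"

lemmas subspace_T = subspace_tangent_space[OF atlas]

lemma phi_phi: "x \<in> T p \<Longrightarrow> \<phi> p (\<phi> p x) = x - \<eta> p x *\<^sub>R \<xi> p"
  and eta_phi: "x \<in> T p \<Longrightarrow> \<eta> p (\<phi> p x) = 0"
  and g_xi: "x \<in> T p \<Longrightarrow> g p x (\<xi> p) = \<eta> p x"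
  and g_phi_phi: "x \<in> T p \<Longrightarrow> y \<in> T p \<Longrightarrow> g p (\<phi> p x) (\<phi> p y) = g p x y - \<eta> p x * \<eta> p y"
  using manifold by (auto simp: apapR_manifold_def)

lemma xi_in_T: "\<xi> p \<in> T p"
  using xi_field by (simp add: smooth_field_on_def)

lemma phi_in_T: "x \<in> T p \<Longrightarrow> \<phi> p x \<in> T p"
  using phi_field unfolding endomorphism_field_def by blast

lemma phi_add: "x \<in> T p \<Longrightarrow> y \<in> T p \<Longrightarrow> \<phi> p (x + y) = \<phi> p x + \<phi> p y"
  and phi_scale: "x \<in> T p \<Longrightarrow> \<phi> p (a *\<^sub>R x) = a *\<^sub>R \<phi> p x"
  using phi_field by (auto simp: endomorphism_field_def linear_within_def)

lemma g_commute: "x \<in> T p \<Longrightarrow> y \<in> T p \<Longrightarrow> g p x y = g p y x"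
  and g_pos: "x \<in> T p \<Longrightarrow> x \<noteq> 0 \<Longrightarrow> g p x x > 0"
  and g_add_right: "x \<in> T p \<Longrightarrow> y \<in> T p \<Longrightarrow> z \<in> T p \<Longrightarrow> g p x (y + z) = g p x y + g p x z"
  and g_scale_right: "x \<in> T p \<Longrightarrow> y \<in> T p \<Longrightarrow> g p x (a *\<^sub>R y) = a * g p x y"
  using g_field by (auto simp: riemannian_metric_def linear_within_def)

lemma g_add_left: "x \<in> T p \<Longrightarrow> y \<in> T p \<Longrightarrow> z \<in> T p \<Longrightarrow> g p (x + y) z = g p x z + g p y z"
  using g_commute g_add_right subspace_add[OF subspace_T] by metis

lemma g_scale_left: "x \<in> T p \<Longrightarrow> y \<in> T p \<Longrightarrow> g p (a *\<^sub>R x) y = a * g p x y"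
  using g_commute g_scale_right subspace_scale[OF subspace_T] by metis

lemma g_minus_left: "x \<in> T p \<Longrightarrow> y \<in> T p \<Longrightarrow> g p (- x) y = - g p x y"
  using g_scale_left[of x p y "-1"] by simp

lemma g_diff_left: "x \<in> T p \<Longrightarrow> y \<in> T p \<Longrightarrow> z \<in> T p \<Longrightarrow> g p (x - y) z = g p x z - g p y z"
  using g_add_left[of x p "- y" z] g_minus_left[of y p z] subspace_neg[OF subspace_T] by simp

lemma g_diff_right: "x \<in> T p \<Longrightarrow> y \<in> T p \<Longrightarrow> z \<in> T p \<Longrightarrow> g p x (y - z) = g p x y - g p x z"
  using g_commute g_diff_left subspace_diff[OF subspace_T] by metis

text \<open>Evaluate \<open>g(\<phi>x, \<phi>y) = g(x, y) - \<eta>(x)\<eta>(y)\<close> with \<open>\<phi>y\<close> in place of \<open>y\<close>: the term with \<open>\<eta>\<close> vanishes, and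
  \<open>\<phi>\<^sup>2 y\<close> differs from \<open>y\<close> by a multiple of \<open>\<xi>\<close>, which is orthogonal to \<open>\<phi>x\<close>.\<close>

lemma phi_selfadjoint:
  assumes "x \<in> T p" "y \<in> T p"
  shows "g p (\<phi> p x) y = g p x (\<phi> p y)"
proof -
  have "g p (\<phi> p x) (\<phi> p (\<phi> p y)) = g p x (\<phi> p y)"
    using assms by (simp add: g_phi_phi phi_in_T eta_phi)
  moreover have "g p (\<phi> p x) (\<phi> p (\<phi> p y)) = g p (\<phi> p x) y"
    using assms by (simp add: phi_phi g_diff_right g_scale_right phi_in_T xi_in_T
        subspace_scale[OF subspace_T] g_xi eta_phi)
  ultimately show ?thesis by simp
qed

definition smooth_near :: "'m \<Rightarrow> ('m \<Rightarrow> ('m, 'e) tvec) \<Rightarrow> bool"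
  where "smooth_near p X \<longleftrightarrow> (\<exists>U. open U \<and> p \<in> U \<and> smooth_field_on A U X)"

lemma smooth_near_in_T: "smooth_near p X \<Longrightarrow> X p \<in> T p"
  by (auto simp: smooth_near_def smooth_field_on_def)

lemma smooth_near_phi: "smooth_near p X \<Longrightarrow> smooth_near p (\<lambda>q. \<phi> q (X q))"
  using phi_field by (auto simp: smooth_near_def endomorphism_field_def)

lemma smooth_near_xi: "smooth_near p \<xi>"
  using xi_field by (auto simp: smooth_near_def)

lemma smooth_near2:
  assumes "smooth_near p X" "smooth_near p Y"
  obtains U where "open U" "p \<in> U" "smooth_field_on A U X" "smooth_field_on A U Y"
proof -
  obtain U W where "open U" "p \<in> U" "smooth_field_on A U X"
    and "open W" "p \<in> W" "smooth_field_on A W Y"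
    using assms by (auto simp: smooth_near_def)
  then show ?thesis
    using that[of "U \<inter> W"] by (auto intro: smooth_field_on_subset)
qed

lemmas nabla_axioms = nabla_connection[unfolded linear_connection_def]
lemmas nabla_linear_field = nabla_axioms[THEN conjunct2, THEN conjunct1, rule_format]
lemmas nabla_add_fields = nabla_axioms[THEN conjunct2, THEN conjunct2, THEN conjunct1, rule_format]
lemmas nabla_Leibniz = nabla_axioms[THEN conjunct2, THEN conjunct2, THEN conjunct2, rule_format]
lemmas nabla_metric = connection[unfolded levi_civita_def, THEN conjunct2, THEN conjunct2, rule_format]

lemma nabla_linear: "smooth_near p Y \<Longrightarrow> linear_within (T p) (\<lambda>x. nabla p x Y)"
  and nabla_in_T: "smooth_near p Y \<Longrightarrow> x \<in> T p \<Longrightarrow> nabla p x Y \<in> T p"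
  unfolding smooth_near_def using nabla_linear_field by blast+

lemma nabla_add:
  assumes "x \<in> T p" "smooth_near p Y" "smooth_near p Z"
  shows "nabla p x (\<lambda>q. Y q + Z q) = nabla p x Y + nabla p x Z"
proof -
  obtain U where "open U" "p \<in> U" "smooth_field_on A U Y" "smooth_field_on A U Z"
    using smooth_near2[OF assms(2,3)] .
  with \<open>x \<in> T p\<close> show ?thesis
    by (intro nabla_add_fields)
qed

lemma deriv_along_g:
  assumes "x \<in> T p" "smooth_near p Y" "smooth_near p Z"
  shows "deriv_along A p x (\<lambda>q. g q (Y q) (Z q)) = g p (nabla p x Y) (Z p) + g p (Y p) (nabla p x Z)"
proof -
  obtain U where "open U" "p \<in> U" "smooth_field_on A U Y" "smooth_field_on A U Z"
    using smooth_near2[OF assms(2,3)] .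
  with \<open>x \<in> T p\<close> show ?thesis
    by (intro nabla_metric)
qed

lemma extension_exists:
  assumes "v \<in> T p"
  obtains V where "smooth_near p V" "\<And>q. V q \<in> T q" "V p = v"
  using smooth_extension_exists[OF atlas assms] unfolding smooth_near_def by metis

text \<open>\<open>(\<nabla>\<^sub>x \<phi>) Y\<close> for a vector field \<open>Y\<close>, before it is known to depend on \<open>Y p\<close> only.\<close>

definition nabla_phi :: "'m \<Rightarrow> ('m, 'e) tvec \<Rightarrow> ('m \<Rightarrow> ('m, 'e) tvec) \<Rightarrow> ('m, 'e) tvec"
  where "nabla_phi p x Y = nabla p x (\<lambda>q. \<phi> q (Y q)) - \<phi> p (nabla p x Y)"

lemma nabla_phi_in_T: "smooth_near p Y \<Longrightarrow> x \<in> T p \<Longrightarrow> nabla_phi p x Y \<in> T p"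
  unfolding nabla_phi_def
  by (intro subspace_diff[OF subspace_T] nabla_in_T phi_in_T smooth_near_phi)

text \<open>Differentiate \<open>g(\<phi>Y, Z) = g(Y, \<phi>Z)\<close> along \<open>x\<close>; the connection is metric.\<close>

lemma nabla_phi_selfadjoint:
  assumes x: "x \<in> T p" and Y: "smooth_near p Y" and Z: "smooth_near p Z"
  shows "g p (nabla_phi p x Y) (Z p) = g p (Y p) (nabla_phi p x Z)"
proof -
  obtain U where "open U" "p \<in> U" "smooth_field_on A U Y" "smooth_field_on A U Z"
    using smooth_near2[OF Y Z] .
  then have "deriv_along A p x (\<lambda>q. g q (\<phi> q (Y q)) (Z q))
      = deriv_along A p x (\<lambda>q. g q (Y q) (\<phi> q (Z q)))"
    by (intro deriv_along_cong[OF atlas]) (auto simp: phi_selfadjoint smooth_field_on_def)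
  then have "g p (nabla p x (\<lambda>q. \<phi> q (Y q))) (Z p) + g p (\<phi> p (Y p)) (nabla p x Z)
      = g p (nabla p x Y) (\<phi> p (Z p)) + g p (Y p) (nabla p x (\<lambda>q. \<phi> q (Z q)))"
    using deriv_along_g[OF x smooth_near_phi[OF Y] Z]
      deriv_along_g[OF x Y smooth_near_phi[OF Z]] by simp
  moreover note in_T = x smooth_near_in_T[OF Y] smooth_near_in_T[OF Z] nabla_in_T[OF Y x]
    nabla_in_T[OF Z x] nabla_in_T[OF smooth_near_phi[OF Y] x]
    nabla_in_T[OF smooth_near_phi[OF Z] x]
  ultimately show ?thesis
    by (simp add: nabla_phi_def g_diff_left g_diff_right phi_in_T phi_selfadjoint)
qed

text \<open>The value \<open>g((\<nabla>\<^sub>x \<phi>) Y, Z) = g(Y, (\<nabla>\<^sub>x \<phi>) Z)\<close> at \<open>p\<close> depends on \<open>Y p\<close> only. As every tangent vector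
  is the value of some smooth \<open>Z\<close> and \<open>g\<close> is positive definite, so does \<open>(\<nabla>\<^sub>x \<phi>) Y\<close>.\<close>

lemma nabla_phi_tensorial:
  assumes x: "x \<in> T p" and Y: "smooth_near p Y" and Y': "smooth_near p Y'" and eq: "Y p = Y' p"
  shows "nabla_phi p x Y = nabla_phi p x Y'"
proof -
  let ?d = "nabla_phi p x Y - nabla_phi p x Y'"
  note in_T = nabla_phi_in_T[OF Y x] nabla_phi_in_T[OF Y' x]
  then have d: "?d \<in> T p"
    by (intro subspace_diff[OF subspace_T])
  then obtain Z where Z: "smooth_near p Z" "Z p = ?d"
    by (rule extension_exists)
  have "g p ?d ?d = 0"
    using nabla_phi_selfadjoint[OF x Y Z(1)] nabla_phi_selfadjoint[OF x Y' Z(1)] Z(2) eq in_T d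
    by (simp add: g_diff_left)
  then have "?d = 0"
    using g_pos[OF d] by fastforce
  then show ?thesis by simp
qed

lemma cov_deriv_endo_eq_nabla_phi:
  assumes x: "x \<in> T p" and Y: "smooth_near p Y"
  shows "cov_deriv_endo A nabla \<phi> p x (Y p) = nabla_phi p x Y"
proof -
  define Y' where "Y' = (SOME Y'. Y' p = Y p \<and> (\<exists>U. open U \<and> p \<in> U \<and> smooth_field_on A U Y'))"
  have "\<exists>Y'. Y' p = Y p \<and> (\<exists>U. open U \<and> p \<in> U \<and> smooth_field_on A U Y')"
    using Y by (auto simp: smooth_near_def)
  then have "Y' p = Y p \<and> (\<exists>U. open U \<and> p \<in> U \<and> smooth_field_on A U Y')"
    unfolding Y'_def by (rule someI_ex)
  then have Y': "smooth_near p Y'" "Y' p = Y p"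
    by (auto simp: smooth_near_def)
  then have "nabla_phi p x Y' = nabla_phi p x Y"
    using x Y by (intro nabla_phi_tensorial)
  then show ?thesis
    unfolding cov_deriv_endo_def Y'_def[symmetric] nabla_phi_def Let_def .
qed

abbreviation F where "F p \<equiv> fundamental_tensor A nabla \<phi> g p"

lemma F_eq: "x \<in> T p \<Longrightarrow> smooth_near p Y \<Longrightarrow> F p x (Y p) z = g p (nabla_phi p x Y) z"
  by (simp add: fundamental_tensor_def cov_deriv_endo_eq_nabla_phi)

lemma F_commute:
  assumes "x \<in> T p" "y \<in> T p" "z \<in> T p"
  shows "F p x y z = F p x z y"
proof -
  obtain Y where "smooth_near p Y" "Y p = y"
    using extension_exists[OF assms(2)] .
  moreover obtain Z where "smooth_near p Z" "Z p = z"
    using extension_exists[OF assms(3)] .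
  ultimately show ?thesis
    using assms nabla_phi_selfadjoint[of x p Y Z] F_eq[of x p Y z] F_eq[of x p Z y]
    by (simp add: g_commute nabla_phi_in_T)
qed

lemma cov_deriv_endo_in_T:
  "x \<in> T p \<Longrightarrow> y \<in> T p \<Longrightarrow> cov_deriv_endo A nabla \<phi> p x y \<in> T p"
  by (metis extension_exists cov_deriv_endo_eq_nabla_phi nabla_phi_in_T)

lemma F_linear3: "x \<in> T p \<Longrightarrow> y \<in> T p \<Longrightarrow> linear_within (T p) (F p x y)"
  by (simp add: linear_within_def fundamental_tensor_def g_add_right g_scale_right cov_deriv_endo_in_T)

text \<open>The definition of \<open>F\<close> picks an extension of \<open>y\<close> for each \<open>y\<close> separately, which hides the
  linearity in \<open>y\<close>; the symmetry of \<open>F\<close> carries it over from the last argument.\<close>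

lemma F_linear2:
  assumes "x \<in> T p" "z \<in> T p" shows "linear_within (T p) (\<lambda>y. F p x y z)"
proof -
  have "F p x y z = F p x z y" if "y \<in> T p" for y
    using assms that by (intro F_commute)
  then show ?thesis
    using F_linear3[OF assms] subspace_add[OF subspace_T] subspace_scale[OF subspace_T]
    by (simp add: linear_within_def)
qed

lemma F_linear1:
  assumes "y \<in> T p" "z \<in> T p" shows "linear_within (T p) (\<lambda>x. F p x y z)"
proof -
  obtain Y where Y: "smooth_near p Y" "Y p = y"
    using extension_exists[OF assms(1)] .
  have F: "F p x y z = g p (nabla p x (\<lambda>q. \<phi> q (Y q))) z - g p (\<phi> p (nabla p x Y)) z"
    if "x \<in> T p" for x
    using F_eq[OF that Y(1)] Y that assms
    by (simp add: nabla_phi_def g_diff_left nabla_in_T smooth_near_phi phi_in_T)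
  show ?thesis
    using nabla_linear[OF Y(1)] nabla_linear[OF smooth_near_phi[OF Y(1)]] assms Y
    by (auto simp: linear_within_def F subspace_add[OF subspace_T] subspace_scale[OF subspace_T]
        phi_add phi_scale g_add_left g_scale_left nabla_in_T smooth_near_phi phi_in_T algebra_simps)
qed

lemma nabla_zero_field:
  assumes "x \<in> T p" shows "nabla p x (\<lambda>q. 0) = 0"
proof -
  have "smooth_near p (\<lambda>q. 0)"
    using smooth_near_phi[OF smooth_near_xi] by (simp add: phi_xi)
  then show ?thesis
    using nabla_add[OF assms, of "\<lambda>q. 0" "\<lambda>q. 0"] by simp
qed

lemma F_xi:
  assumes "x \<in> T p" "z \<in> T p"
  shows "F p x (\<xi> p) z = - g p (nabla p x \<xi>) (\<phi> p z)"
  using assms F_eq[OF assms(1) smooth_near_xi, of z]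
  by (simp add: nabla_phi_def phi_xi nabla_zero_field g_minus_left phi_in_T nabla_in_T
      smooth_near_xi phi_selfadjoint)

lemma smooth_near_eta_xi:
  assumes "smooth_near p Y"
  shows "smooth_near p (\<lambda>q. \<eta> q (Y q) *\<^sub>R \<xi> q)"
proof -
  obtain U where U: "open U" "p \<in> U" "smooth_field_on A U Y" "smooth_field_on A U \<xi>"
    using smooth_near2[OF assms smooth_near_xi] .
  have eta: "smooth_fun_on A U (\<lambda>q. \<eta> q (Y q))"
    using eta_field U unfolding one_form_def by blast
  have "smooth_on (snd c ` (U \<inter> fst c))
      (\<lambda>u. (\<eta> (chart_inv c u) (Y (chart_inv c u)) *\<^sub>R \<xi> (chart_inv c u)) c)" if "c \<in> A" for c
  proof -
    have S: "open (snd c ` (U \<inter> fst c))"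
      using atlas that U by (auto simp: smooth_atlas_def intro: open_chart_image)
    show ?thesis
      using eta U that
      by (auto simp: smooth_on_def smooth_fun_on_def smooth_field_on_def scaleR_fun_def
          intro!: Ck_on_bilinear[OF bounded_bilinear_scaleR S])
  qed
  moreover have "\<eta> q (Y q) *\<^sub>R \<xi> q \<in> T q" for q
    by (intro subspace_scale[OF subspace_T] xi_in_T)
  ultimately show ?thesis
    using U by (auto simp: smooth_near_def smooth_field_on_def)
qed

text \<open>The Leibniz rule, with \<open>x(\<eta>(Y)) = x(g(Y, \<xi>))\<close> expanded by the metric property.\<close>

lemma nabla_eta_xi:
  assumes x: "x \<in> T p" and Y: "smooth_near p Y"
  shows "nabla p x (\<lambda>q. \<eta> q (Y q) *\<^sub>R \<xi> q)
    = (\<eta> p (nabla p x Y) + g p (Y p) (nabla p x \<xi>)) *\<^sub>R \<xi> p + \<eta> p (Y p) *\<^sub>R nabla p x \<xi>"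
proof -
  obtain U where U: "open U" "p \<in> U" "smooth_field_on A U Y" "smooth_field_on A U \<xi>"
    using smooth_near2[OF Y smooth_near_xi] .
  have "deriv_along A p x (\<lambda>q. \<eta> q (Y q)) = deriv_along A p x (\<lambda>q. g q (Y q) (\<xi> q))"
    using U by (intro deriv_along_cong[OF atlas U(1,2)]) (simp add: g_xi smooth_field_on_def)
  also have "\<dots> = \<eta> p (nabla p x Y) + g p (Y p) (nabla p x \<xi>)"
    by (simp add: deriv_along_g[OF x Y smooth_near_xi] g_xi nabla_in_T[OF Y x])
  finally have "deriv_along A p x (\<lambda>q. \<eta> q (Y q)) = \<eta> p (nabla p x Y) + g p (Y p) (nabla p x \<xi>)" .
  moreover have "smooth_fun_on A U (\<lambda>q. \<eta> q (Y q))"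
    using eta_field U unfolding one_form_def by blast
  then have "nabla p x (\<lambda>q. \<eta> q (Y q) *\<^sub>R \<xi> q)
      = deriv_along A p x (\<lambda>q. \<eta> q (Y q)) *\<^sub>R \<xi> p + \<eta> p (Y p) *\<^sub>R nabla p x \<xi>"
    using U x by (intro nabla_Leibniz)
  ultimately show ?thesis by simp
qed

text \<open>This is \<open>(\<nabla>\<^sub>x \<phi>) \<phi> + \<phi> (\<nabla>\<^sub>x \<phi>) = \<nabla>\<^sub>x (\<phi>\<^sup>2)\<close>, where the right-hand side comes from
  differentiating \<open>\<phi>\<^sup>2 Y = Y - \<eta>(Y) \<xi>\<close>.\<close>

lemma nabla_phi_anticommute:
  assumes x: "x \<in> T p" and Y: "smooth_near p Y" and tangent: "\<And>q. Y q \<in> T q"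
  shows "nabla_phi p x (\<lambda>q. \<phi> q (Y q)) + \<phi> p (nabla_phi p x Y)
    = - (g p (Y p) (nabla p x \<xi>) *\<^sub>R \<xi> p) - \<eta> p (Y p) *\<^sub>R nabla p x \<xi>"
proof -
  note phi_Y = smooth_near_phi[OF Y]
  have "(\<lambda>q. \<phi> q (\<phi> q (Y q)) + \<eta> q (Y q) *\<^sub>R \<xi> q) = Y"
    using tangent by (simp add: phi_phi)
  then have split: "nabla p x Y = nabla p x (\<lambda>q. \<phi> q (\<phi> q (Y q))) + nabla p x (\<lambda>q. \<eta> q (Y q) *\<^sub>R \<xi> q)"
    using nabla_add[OF x smooth_near_phi[OF phi_Y] smooth_near_eta_xi[OF Y]] by simp
  have "nabla_phi p x (\<lambda>q. \<phi> q (Y q)) + \<phi> p (nabla_phi p x Y)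
      = nabla p x (\<lambda>q. \<phi> q (\<phi> q (Y q))) - \<phi> p (\<phi> p (nabla p x Y))"
  proof -
    have "\<phi> p (u - v) = \<phi> p u - \<phi> p v" if "u \<in> T p" "v \<in> T p" for u v
      using phi_add[of "u - v" p v] that subspace_diff[OF subspace_T] by (simp add: algebra_simps)
    then show ?thesis
      using nabla_in_T[OF Y x] nabla_in_T[OF phi_Y x] by (simp add: nabla_phi_def phi_in_T)
  qed
  also have "\<dots> = \<eta> p (nabla p x Y) *\<^sub>R \<xi> p - nabla p x (\<lambda>q. \<eta> q (Y q) *\<^sub>R \<xi> q)"
    using nabla_in_T[OF Y x] split by (simp add: phi_phi)
  also have "\<dots> = - (g p (Y p) (nabla p x \<xi>) *\<^sub>R \<xi> p) - \<eta> p (Y p) *\<^sub>R nabla p x \<xi>"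
    by (simp add: nabla_eta_xi[OF x Y] scaleR_left_distrib)
  finally show ?thesis .
qed

text \<open>Apply \<open>nabla_phi_anticommute\<close> to an extension of \<open>y\<close> and pair with \<open>\<phi>z\<close>. The term along \<open>\<xi>\<close> drops
  out, and by \<open>F_xi\<close> the term with \<open>\<nabla>\<^sub>x \<xi>\<close> is \<open>\<eta>(y) F(x, \<xi>, z)\<close>.\<close>

lemma F_phi_phi:
  assumes x: "x \<in> T p" and y: "y \<in> T p" and z: "z \<in> T p"
  shows "F p x (\<phi> p y) (\<phi> p z) = - F p x y z + \<eta> p y * F p x (\<xi> p) z + \<eta> p z * F p x y (\<xi> p)"
proof -
  obtain Y where Y: "smooth_near p Y" "\<And>q. Y q \<in> T q" "Y p = y"
    using extension_exists[OF y] by blast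
  let ?D = "nabla_phi p x Y" and ?N = "nabla p x \<xi>"
  have in_T: "?D \<in> T p" "?N \<in> T p" "\<phi> p z \<in> T p" "\<phi> p ?D \<in> T p" "\<xi> p \<in> T p"
    using x z Y by (simp_all add: nabla_phi_in_T nabla_in_T phi_in_T smooth_near_xi xi_in_T)
  have xi: "g p (\<xi> p) (\<phi> p z) = 0"
    using in_T z g_commute[of "\<xi> p" p "\<phi> p z"] by (simp add: g_xi eta_phi)
  have "nabla_phi p x (\<lambda>q. \<phi> q (Y q)) = - (g p y ?N *\<^sub>R \<xi> p) - \<eta> p y *\<^sub>R ?N - \<phi> p ?D"
    using nabla_phi_anticommute[OF x Y(1,2)] Y(3) by (simp add: algebra_simps)
  then have "F p x (\<phi> p y) (\<phi> p z) = g p (- (g p y ?N *\<^sub>R \<xi> p) - \<eta> p y *\<^sub>R ?N - \<phi> p ?D) (\<phi> p z)"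
    using F_eq[OF x smooth_near_phi[OF Y(1)]] Y(3) by simp
  also have "\<dots> = - (\<eta> p y * g p ?N (\<phi> p z)) - (g p ?D z - \<eta> p ?D * \<eta> p z)"
    using in_T z xi subspace_scale[OF subspace_T] subspace_neg[OF subspace_T] subspace_diff[OF subspace_T]
    by (simp add: g_diff_left g_minus_left g_scale_left g_phi_phi)
  also have "g p ?D z = F p x y z"
    using F_eq[OF x Y(1)] Y(3) by simp
  also have "\<eta> p ?D = F p x y (\<xi> p)"
    using F_eq[OF x Y(1)] Y(3) in_T by (simp add: g_xi)
  also have "g p ?N (\<phi> p z) = - F p x (\<xi> p) z"
    using F_xi[OF x z] by simp
  finally show ?thesis by (simp add: algebra_simps)
qed

end

section \<open>Adapted frames in dimension three\<close>

(* Otherwise the simplifier turns the index of e 1 into Suc 0. *)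
declare One_nat_def [simp del]

text \<open>An orthonormal basis \<open>\<xi>, e\<^sub>1, \<phi> e\<^sub>1\<close> of a three-dimensional tangent space. In it \<open>\<phi>\<close> kills
  \<open>e\<^sub>0\<close> and exchanges \<open>e\<^sub>1\<close> and \<open>e\<^sub>2\<close>.\<close>

locale adapted_frame = levi_civita_apapR_manifold 1 A \<phi> \<xi> \<eta> g nabla
  for A :: "('m::{t2_space, second_countable_topology}, 'e::euclidean_space) chart set"
    and \<phi> \<xi> \<eta> g nabla +
  fixes p :: 'm and e :: "nat \<Rightarrow> ('m, 'e) tvec"
  assumes basis: "orthonormal_basis (g p) (tangent_space A p) {0, 1, 2} e"
    and e0: "e 0 = \<xi> p" and e2: "e 2 = \<phi> p (e 1)"
begin

lemma e_in_T: "e 0 \<in> T p" "e 1 \<in> T p" "e 2 \<in> T p"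
  using basis by (auto simp: orthonormal_basis_def)

lemma eta_e: "\<eta> p (e 0) = 1" "\<eta> p (e 1) = 0" "\<eta> p (e 2) = 0"
proof -
  have "g p (e 1) (e 0) = 0"
    using basis by (simp add: orthonormal_basis_def)
  then show "\<eta> p (e 1) = 0" "\<eta> p (e 0) = 1" "\<eta> p (e 2) = 0"
    using e_in_T(2) by (simp_all add: e0 e2 eta_xi eta_phi g_xi)
qed

lemma phi_e: "\<phi> p (e 0) = 0" "\<phi> p (e 1) = e 2" "\<phi> p (e 2) = e 1"
  using phi_phi[OF e_in_T(2)] eta_e(2) by (simp_all add: e0 e2 phi_xi)

definition vec :: "real \<Rightarrow> real \<Rightarrow> real \<Rightarrow> ('m, 'e) tvec"
  where "vec a b c = a *\<^sub>R e 0 + (b *\<^sub>R e 1 + c *\<^sub>R e 2)"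

lemma e_vec: "e 0 = vec 1 0 0" "e 1 = vec 0 1 0" "e 2 = vec 0 0 1"
  by (simp_all add: vec_def)

lemma vec_in_T: "vec a b c \<in> T p"
  unfolding vec_def by (intro subspace_add[OF subspace_T] subspace_scale[OF subspace_T] e_in_T)

lemma T_vec:
  assumes "u \<in> T p" obtains a b c where "u = vec a b c"
proof -
  have "u \<in> span {e 0, e 1, e 2}"
    using assms basis by (simp add: orthonormal_basis_def)
  then obtain a b c where "u - a *\<^sub>R e 0 - b *\<^sub>R e 1 - c *\<^sub>R e 2 = 0"
    by (auto simp: span_insert)
  then have "u = vec a b c"
    by (simp add: vec_def algebra_simps)
  then show ?thesis by (rule that)
qed

lemma linear_within_vec:
  assumes "linear_within (T p) f"
  shows "f (vec a b c) = a *\<^sub>R f (e 0) + (b *\<^sub>R f (e 1) + c *\<^sub>R f (e 2))"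
  using assms unfolding linear_within_def vec_def
  by (simp add: e_in_T subspace_add[OF subspace_T] subspace_scale[OF subspace_T])

lemma phi_vec: "\<phi> p (vec a b c) = vec 0 c b"
proof -
  have "linear_within (T p) (\<phi> p)"
    using phi_field by (simp add: endomorphism_field_def)
  from linear_within_vec[OF this] show ?thesis
    by (simp add: phi_e) (simp add: vec_def)
qed

lemma eta_vec: "\<eta> p (vec a b c) = a"
proof -
  have "linear_within (T p) (\<eta> p)"
    using eta_field by (simp add: one_form_def)
  from linear_within_vec[OF this] show ?thesis
    by (simp add: eta_e)
qed

lemma g_vec: "g p (vec a b c) (vec a' b' c') = a * a' + b * b' + c * c'"
proof -
  have right: "linear_within (T p) (g p x)" if "x \<in> T p" for x
    using g_field that by (simp add: riemannian_metric_def)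
  have left: "linear_within (T p) (\<lambda>x. g p x y)" if "y \<in> T p" for y
    using that by (simp add: linear_within_def g_add_left g_scale_left)
  have "g p (e 0) (e 0) = 1" "g p (e 1) (e 1) = 1" "g p (e 2) (e 2) = 1"
    "g p (e 0) (e 1) = 0" "g p (e 0) (e 2) = 0" "g p (e 1) (e 2) = 0"
    "g p (e 1) (e 0) = 0" "g p (e 2) (e 0) = 0" "g p (e 2) (e 1) = 0"
    using basis by (simp_all add: orthonormal_basis_def)
  then show ?thesis
    by (simp add: linear_within_vec[OF left] linear_within_vec[OF right] vec_in_T e_in_T)
qed

text \<open>Put frame vectors into \<open>F_phi_phi\<close>. For \<open>\<xi>, \<xi>\<close> it gives \<open>0 = F(x, \<xi>, \<xi>)\<close>. On \<open>e\<^sub>1, e\<^sub>2\<close>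
  the map \<open>\<phi>\<close> is an exchange, so \<open>F(x, e\<^sub>2, e\<^sub>1) = - F(x, e\<^sub>1, e\<^sub>2)\<close>, which the symmetry of \<open>F\<close> turns
  into \<open>0\<close>, and \<open>F(x, e\<^sub>2, e\<^sub>2) = - F(x, e\<^sub>1, e\<^sub>1)\<close>.\<close>

lemma F_frame:
  assumes "x \<in> T p"
  shows "F p x (e 0) (e 0) = 0" "F p x (e 1) (e 2) = 0" "F p x (e 2) (e 2) = - F p x (e 1) (e 1)"
proof -
  note phi_phi_e = F_phi_phi[OF assms, unfolded e0[symmetric]]
  \<comment> \<open>The left-hand side of \<open>F_phi_phi\<close> at \<open>\<xi>, \<xi>\<close> is \<open>F(x, 0, 0)\<close>.\<close>
  have "F p x 0 (0 *\<^sub>R 0) = 0 * F p x 0 0"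
    using F_linear3[OF assms] subspace_0[OF subspace_T] unfolding linear_within_def
    by (metis real_scaleR_def)
  then have zero: "F p x 0 0 = 0"
    by simp
  show "F p x (e 0) (e 0) = 0"
    using phi_phi_e[OF e_in_T(1,1)] zero by (simp add: phi_e eta_e)
  show "F p x (e 1) (e 2) = 0"
    using phi_phi_e[OF e_in_T(2,3)] F_commute[OF assms e_in_T(2,3)] by (simp add: phi_e eta_e)
  show "F p x (e 2) (e 2) = - F p x (e 1) (e 1)"
    using phi_phi_e[OF e_in_T(2,2)] by (simp add: phi_e eta_e)
qed

abbreviation F10 where "F10 i \<equiv> F p (e i) (e 1) (e 0)"
abbreviation F20 where "F20 i \<equiv> F p (e i) (e 2) (e 0)"
abbreviation F11 where "F11 i \<equiv> F p (e i) (e 1) (e 1)"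

text \<open>The value of \<open>F\<close> on vectors with the given coordinates. By \<open>F_frame\<close>, each of the three
  symmetric forms \<open>F(e\<^sub>i, -, -)\<close> has three independent entries, so nine numbers determine \<open>F\<close>.\<close>

definition F_normal_form
  where "F_normal_form x0 x1 x2 y0 y1 y2 z0 z1 z2 =
    (x0 * F10 0 + x1 * F10 1 + x2 * F10 2) * (y0 * z1 + y1 * z0)
    + (x0 * F20 0 + x1 * F20 1 + x2 * F20 2) * (y0 * z2 + y2 * z0)
    + (x0 * F11 0 + x1 * F11 1 + x2 * F11 2) * (y1 * z1 - y2 * z2)"

lemma F_vec:
  "F p (vec x0 x1 x2) (vec y0 y1 y2) (vec z0 z1 z2) = F_normal_form x0 x1 x2 y0 y1 y2 z0 z1 z2"
proof -
  have x: "F p x (vec y0 y1 y2) (vec z0 z1 z2)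
    = F p x (e 1) (e 0) * (y0 * z1 + y1 * z0) + F p x (e 2) (e 0) * (y0 * z2 + y2 * z0)
      + F p x (e 1) (e 1) * (y1 * z1 - y2 * z2)" if x: "x \<in> T p" for x
    using F_frame[OF x] F_commute[OF x e_in_T(1,2)] F_commute[OF x e_in_T(1,3)]
      F_commute[OF x e_in_T(3,2)]
    by (simp add: linear_within_vec[OF F_linear2] linear_within_vec[OF F_linear3]
        x vec_in_T e_in_T algebra_simps)
  show ?thesis
    by (simp add: linear_within_vec[OF F_linear1] x vec_in_T e_in_T F_normal_form_def algebra_simps)
qed

text \<open>The trace of a bilinear form on \<open>ker \<eta>\<close> is the same for all orthonormal bases: the change of
  basis is a \<open>2 \<times> 2\<close> matrix with orthonormal rows, hence with orthonormal columns. Both Lee forms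
  \<open>\<theta>\<close> and \<open>\<theta>*\<close> are such traces.\<close>

lemma trace_ker_eta:
  fixes B :: "('m, 'e) tvec \<Rightarrow> ('m, 'e) tvec \<Rightarrow> real"
  assumes b: "orthonormal_basis (g p) {v \<in> T p. \<eta> p v = 0} {1..2} b"
    and left: "\<And>v. v \<in> T p \<Longrightarrow> linear_within (T p) (\<lambda>u. B u v)"
    and right: "\<And>u. u \<in> T p \<Longrightarrow> linear_within (T p) (B u)"
  shows "B (b 1) (b 1) + B (b 2) (b 2) = B (e 1) (e 1) + B (e 2) (e 2)"
proof -
  have "\<exists>s t. b i = vec 0 s t" if "i \<in> {1..2}" for i
  proof -
    have "b i \<in> T p" "\<eta> p (b i) = 0"
      using b that unfolding orthonormal_basis_def by blast+
    then show ?thesis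
      by (metis T_vec eta_vec)
  qed
  from this[of 1] this[of 2] obtain s t s' t' where b12: "b 1 = vec 0 s t" "b 2 = vec 0 s' t'"
    by auto
  have "g p (b 1) (b 1) = 1" "g p (b 2) (b 2) = 1" "g p (b 1) (b 2) = 0"
    using b by (simp_all add: orthonormal_basis_def)
  then have rows: "s * s + t * t = 1" "s' * s' + t' * t' = 1" "s * s' + t * t' = 0"
    by (simp_all add: b12 g_vec)
  \<comment> \<open>With \<open>d = s t' - t s'\<close> the rows give \<open>d\<^sup>2 = 1\<close>, \<open>s = d t'\<close> and \<open>t = - d s'\<close>.\<close>
  have cols: "s * s + s' * s' = 1" "t * t + t' * t' = 1" "s * t + s' * t' = 0"
    using rows by algebra+
  have "B (b 1) (b 1) + B (b 2) (b 2) = (s * s + s' * s') * B (e 1) (e 1)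
      + (s * t + s' * t') * (B (e 1) (e 2) + B (e 2) (e 1)) + (t * t + t' * t') * B (e 2) (e 2)"
    by (simp add: b12 linear_within_vec[OF left] linear_within_vec[OF right] vec_in_T e_in_T algebra_simps)
  then show ?thesis
    by (simp add: cols)
qed

lemma lee_theta_eq:
  assumes b: "orthonormal_basis (g p) {v \<in> T p. \<eta> p v = 0} {1..2} b" and z: "z \<in> T p"
  shows "lee_theta 1 b (F p) z = F p (e 1) (e 1) z + F p (e 2) (e 2) z"
proof -
  have "{1..2 * 1} = {1, 2::nat}" by auto
  then have "lee_theta 1 b (F p) z = F p (b 1) (b 1) z + F p (b 2) (b 2) z"
    by (simp add: lee_theta_def)
  also have "\<dots> = F p (e 1) (e 1) z + F p (e 2) (e 2) z"
    by (rule trace_ker_eta[OF b, where B = "\<lambda>u v. F p u v z"]) (simp_all only: F_linear1 F_linear2 z)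
  finally show ?thesis .
qed

lemma lee_theta_star_eq:
  assumes b: "orthonormal_basis (g p) {v \<in> T p. \<eta> p v = 0} {1..2} b" and z: "z \<in> T p"
  shows "lee_theta_star 1 b (\<phi> p) (F p) z = F p (e 1) (e 2) z + F p (e 2) (e 1) z"
proof -
  have "{1..2 * 1} = {1, 2::nat}" by auto
  then have "lee_theta_star 1 b (\<phi> p) (F p) z = F p (b 1) (\<phi> p (b 1)) z + F p (b 2) (\<phi> p (b 2)) z"
    by (simp add: lee_theta_star_def)
  also have "\<dots> = F p (e 1) (\<phi> p (e 1)) z + F p (e 2) (\<phi> p (e 2)) z"
  proof (rule trace_ker_eta[OF b, where B = "\<lambda>u v. F p u (\<phi> p v) z"])
    show "linear_within (T p) (\<lambda>v. F p u (\<phi> p v) z)" if "u \<in> T p" for u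
      using F_linear2[OF that z] by (simp add: linear_within_def phi_in_T phi_add phi_scale)
  qed (simp add: F_linear1 z phi_in_T)
  finally show ?thesis by (simp add: phi_e)
qed

end

section \<open>The components of the fundamental tensor\<close>

theorem proposition3p1:
  fixes A :: "('m::{t2_space, second_countable_topology}, 'e::euclidean_space) chart set"
    and \<phi> :: "'m \<Rightarrow> ('m, 'e) tvec \<Rightarrow> ('m, 'e) tvec"
    and \<xi> :: "'m \<Rightarrow> ('m, 'e) tvec"
    and \<eta> :: "'m \<Rightarrow> ('m, 'e) tvec \<Rightarrow> real"
    and g :: "'m \<Rightarrow> ('m, 'e) tvec \<Rightarrow> ('m, 'e) tvec \<Rightarrow> real"
    and nabla :: "'m \<Rightarrow> ('m, 'e) tvec \<Rightarrow> ('m \<Rightarrow> ('m, 'e) tvec) \<Rightarrow> ('m, 'e) tvec"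
    and p :: 'm
    and e b :: "nat \<Rightarrow> ('m, 'e) tvec"
    and x y z :: "nat \<Rightarrow> real"
    and X Y Z :: "('m, 'e) tvec"
    and F :: "('m, 'e) tvec \<Rightarrow> ('m, 'e) tvec \<Rightarrow> ('m, 'e) tvec \<Rightarrow> real"
    and \<theta> \<theta>s \<omega> :: "('m, 'e) tvec \<Rightarrow> real"
    and lam mu nu :: real
  assumes manifold: "apapR_manifold 1 A \<phi> \<xi> \<eta> g"
    and connection: "levi_civita A g nabla"
    and F: "F = fundamental_tensor A nabla \<phi> g p"
    and basis: "orthonormal_basis (g p) (tangent_space A p) {0, 1, 2} e"
    and e0: "e 0 = \<xi> p" and e2: "e 2 = \<phi> p (e 1)"
    and lee_basis: "orthonormal_basis (g p) {v \<in> tangent_space A p. \<eta> p v = 0} {1..2} b"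
    and \<theta>: "\<theta> = lee_theta 1 b F"
    and \<theta>s: "\<theta>s = lee_theta_star 1 b (\<phi> p) F"
    and \<omega>: "\<omega> = lee_omega (\<xi> p) F"
    and X: "X = (\<Sum>i\<in>{0, 1, 2}. x i *\<^sub>R e i)"
    and Y: "Y = (\<Sum>i\<in>{0, 1, 2}. y i *\<^sub>R e i)"
    and Z: "Z = (\<Sum>i\<in>{0, 1, 2}. z i *\<^sub>R e i)"
    and lam: "lam = (F (e 1) (e 1) (e 0) - F (e 2) (e 2) (e 0)) / 2"
    and mu: "mu = (F (e 1) (e 2) (e 0) - F (e 2) (e 1) (e 0)) / 2"
    and nu: "nu = F (e 0) (e 1) (e 1)"
  shows
    "F1_comp 1 (\<phi> p) (g p) \<theta> X Y Z =
       (x 1 * \<theta> (e 1) - x 2 * \<theta> (e 2)) * (y 1 * z 1 - y 2 * z 2) \<and>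
     F2_comp 1 (\<phi> p) (g p) \<theta> F X Y Z = 0 \<and>
     F3_comp (\<phi> p) F X Y Z = 0 \<and>
     F4_comp 1 (\<phi> p) (\<xi> p) (\<eta> p) (g p) \<theta> X Y Z =
       \<theta> (e 0) / 2 * (x 1 * (y 0 * z 1 + y 1 * z 0) + x 2 * (y 0 * z 2 + y 2 * z 0)) \<and>
     F5_comp 1 (\<phi> p) (\<xi> p) (\<eta> p) (g p) \<theta>s X Y Z =
       \<theta>s (e 0) / 2 * (x 1 * (y 0 * z 2 + y 2 * z 0) + x 2 * (y 0 * z 1 + y 1 * z 0)) \<and>
     F6_comp 1 (\<phi> p) (\<xi> p) (\<eta> p) (g p) \<theta> \<theta>s F X Y Z = 0 \<and>
     F7_comp (\<phi> p) (\<xi> p) (\<eta> p) F X Y Z = 0 \<and>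
     F8_comp (\<phi> p) (\<xi> p) (\<eta> p) F X Y Z =
       lam * (x 1 * (y 0 * z 1 + y 1 * z 0) - x 2 * (y 0 * z 2 + y 2 * z 0)) \<and>
     F9_comp (\<phi> p) (\<xi> p) (\<eta> p) F X Y Z =
       mu * (x 1 * (y 0 * z 2 + y 2 * z 0) - x 2 * (y 0 * z 1 + y 1 * z 0)) \<and>
     F10_comp (\<phi> p) (\<xi> p) (\<eta> p) F X Y Z = nu * x 0 * (y 1 * z 1 - y 2 * z 2) \<and>
     F11_comp (\<eta> p) \<omega> X Y Z =
       x 0 * (\<omega> (e 1) * (y 0 * z 1 + y 1 * z 0) + \<omega> (e 2) * (y 0 * z 2 + y 2 * z 0)) \<and>

     lam = F8_comp (\<phi> p) (\<xi> p) (\<eta> p) F (e 1) (e 1) (e 0) \<and>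
     lam = - F8_comp (\<phi> p) (\<xi> p) (\<eta> p) F (e 2) (e 2) (e 0) \<and>
     (lam = F (e 1) (e 1) (e 0) \<and> lam = - F (e 2) (e 2) (e 0) \<longleftrightarrow> \<theta> (e 0) = 0) \<and>
     mu = F9_comp (\<phi> p) (\<xi> p) (\<eta> p) F (e 1) (e 2) (e 0) \<and>
     mu = - F9_comp (\<phi> p) (\<xi> p) (\<eta> p) F (e 2) (e 1) (e 0) \<and>
     (mu = F (e 1) (e 2) (e 0) \<and> mu = - F (e 2) (e 1) (e 0) \<longleftrightarrow> \<theta>s (e 0) = 0) \<and>
     nu = - F (e 0) (e 2) (e 2) \<and>

     \<theta> (e 0) = F (e 1) (e 1) (e 0) + F (e 2) (e 2) (e 0) \<and>
     \<theta> (e 1) = F (e 1) (e 1) (e 1) \<and>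
     F (e 1) (e 1) (e 1) = - F (e 1) (e 2) (e 2) \<and>
     - F (e 1) (e 2) (e 2) = - \<theta>s (e 2) \<and>
     \<theta> (e 2) = F (e 2) (e 2) (e 2) \<and>
     F (e 2) (e 2) (e 2) = - F (e 2) (e 1) (e 1) \<and>
     - F (e 2) (e 1) (e 1) = - \<theta>s (e 1) \<and>
     \<theta>s (e 0) = F (e 1) (e 2) (e 0) + F (e 2) (e 1) (e 0) \<and>
     \<omega> (e 0) = 0 \<and>
     \<omega> (e 1) = F (e 0) (e 0) (e 1) \<and>
     \<omega> (e 2) = F (e 0) (e 0) (e 2)"
proof -
  interpret adapted_frame A \<phi> \<xi> \<eta> g nabla p e
    using manifold connection basis e0 e2 by unfold_locales
  have vecs: "X = vec (x 0) (x 1) (x 2)" "Y = vec (y 0) (y 1) (y 2)" "Z = vec (z 0) (z 1) (z 2)"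
    by (simp_all add: X Y Z vec_def)
  have xi: "\<xi> p = vec 1 0 0"
    using e0 e_vec(1) by simp
  have theta_vec: "\<theta> (vec a b c) = F_normal_form 0 1 0 0 1 0 a b c + F_normal_form 0 0 1 0 0 1 a b c" for a b c
    using lee_theta_eq[OF lee_basis vec_in_T] by (simp add: \<theta> F e_vec F_vec)
  have thetas_vec: "\<theta>s (vec a b c) = F_normal_form 0 1 0 0 0 1 a b c + F_normal_form 0 0 1 0 1 0 a b c" for a b c
    using lee_theta_star_eq[OF lee_basis vec_in_T] by (simp add: \<theta>s F e_vec F_vec)
  \<comment> \<open>All of \<open>\<phi>\<close>, \<open>\<eta>\<close>, \<open>g\<close>, \<open>F\<close>, \<open>\<theta>\<close>, \<open>\<theta>*\<close> are now explicit in coordinates, so every claim is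
    an identity between polynomials in the coordinates and the nine components of \<open>F\<close>.\<close>
  note vec_simps = phi_vec eta_vec g_vec F_vec theta_vec thetas_vec e_vec
  show ?thesis
    unfolding vecs xi lam mu nu \<omega> F F1_comp_def F2_comp_def F3_comp_def F4_comp_def F5_comp_def F6_comp_def
      F7_comp_def F8_comp_def F9_comp_def F10_comp_def F11_comp_def bracket_def b_form_def c_form_def
      lee_omega_def vec_simps
    by (intro conjI) (simp_all add: F_normal_form_def field_simps, linarith+)
qed

end
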